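(* Let $W$ be a finite Coxeter group and $\sqsubseteq$ the cutting-point relation on $W$. (1) $(W,\sqsubseteq)$ is a poset with $1$ as minimal element; it is a subposet of both left and right order (i.e. $v\sqsubseteq w$ implies $v\le_L w$ and $v\le_R w$). Every interval of $(W,\sqsubseteq)$ is a sublattice of both left and right order. (2) For every $w\in W$, the $\sqsubseteq$-lower covers of $w$ correspond (via $K\mapsto w^K$) to the nontrivial right blocks $K$ of $w$ which are minimal for inclusion among nontrivial right blocks. The meet-semilattice $L_w$ generated by the $\sqsubseteq$-lower covers of $w$ is free, and is in correspondence with the lattice of unions of these minimal nontrivial blocks, or alternatively with the lattice of intersections of the intervals $[1,u]_R$ for $u$ ranging over the $\sqsubseteq$-lower covers of $w$. (3) The Möbius function $\mu$ of $(W,\sqsubseteq)$ is given, for $u\sqsubseteq w$, by $\mu(u,w)=\pm1$ if $u\in L_w$, with sign given by the usual rule for the Boolean lattice (that is, $\mu(u,w)=(-1)^r$ if $u$ is the meet of exactly $r$ distinct lower covers of $w$), and $\mu(u,w)=0$ if $u\notin L_w$.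
   Context: $W$ is a finite Coxeter group with simple reflections $(s_i)_{i\in I}$ and identity $1$. Right (resp. left) weak order: $u\le_R v$ (resp. $u\le_L v$) if some reduced word of $u$ is a left factor/prefix (resp. right factor/suffix) of a reduced word of $v$; $[1,u]_R=\{x:x\le_R u\}$. For $J\subseteq I$, $W_J=\langle s_j:j\in J\rangle$. For $K\subseteq I$, each $w$ factors uniquely as $w=w^K\,{}_Kw$ with ${}_Kw\in W_K$ and $w^K$ the minimal length element of $wW_K$. $K\subseteq I$ is a right block of $w$ if there exists $J\subseteq I$ with $wW_K=W_Jw$; in that case $v:=w^K$ is called a cutting point of $w$, written $v\sqsubseteq w$. A right block $K$ is nontrivial if $w^K\ne w$. $L_w$ consists of all meets (in the lattice interval $[1,w]_\sqsubseteq$) of sets of $\sqsubseteq$-lower covers of $w$, the empty meet being $w$; "free" means that distinct sets of lower covers have distinct meets. *)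

theory Defs
  imports "HOL-Algebra.Lattice" "HOL-Algebra.Multiplicative_Group" "HOL-Algebra.Generated_Groups"
begin

section \<open>Coxeter systems\<close>

definition word_prod :: "('a, 'b) monoid_scheme \<Rightarrow> ('i \<Rightarrow> 'a) \<Rightarrow> 'i list \<Rightarrow> 'a" where
  "word_prod G s xs = foldr (\<lambda>i g. s i \<otimes>\<^bsub>G\<^esub> g) xs \<one>\<^bsub>G\<^esub>"

text \<open>
  The congruence on the free monoid of words over \<open>I\<close> generated by \<open>(i j)^(m i j) = 1\<close>.
  If \<open>m i i = 1\<close> then every letter is its own inverse, so the quotient monoid is the group
  presented by these relations. A value \<open>m i j = 0\<close> gives the empty relation; it plays the role
  of an infinite exponent.
\<close>
inductive word_cong :: "('i \<Rightarrow> 'i \<Rightarrow> nat) \<Rightarrow> 'i set \<Rightarrow> 'i list \<Rightarrow> 'i list \<Rightarrow> bool"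
  for m :: "'i \<Rightarrow> 'i \<Rightarrow> nat" and I :: "'i set" where
  refl: "xs \<in> lists I \<Longrightarrow> word_cong m I xs xs"
| sym: "word_cong m I xs ys \<Longrightarrow> word_cong m I ys xs"
| trans: "word_cong m I xs ys \<Longrightarrow> word_cong m I ys zs \<Longrightarrow> word_cong m I xs zs"
| relator: "xs \<in> lists I \<Longrightarrow> ys \<in> lists I \<Longrightarrow> i \<in> I \<Longrightarrow> j \<in> I \<Longrightarrow>
    word_cong m I (xs @ concat (replicate (m i j) [i, j]) @ ys) (xs @ ys)"

text \<open>
  Bourbaki's definition: the \<open>s i\<close> are distinct elements of order 2 generating \<open>G\<close>, and the
  relations \<open>(s i s j)^m(i,j) = 1\<close>, where \<open>m(i,j)\<close> is the order of \<open>s i s j\<close>, present \<open>G\<close>.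
  (\<open>group.ord\<close> is 0 for elements of infinite order.)
\<close>
locale coxeter_system = group G for G (structure) +
  fixes I :: "'i set" and s :: "'i \<Rightarrow> 'a"
  assumes simple_closed: "s \<in> I \<rightarrow> carrier G"
    and simple_inj: "inj_on s I"
    and simple_ord: "i \<in> I \<Longrightarrow> ord (s i) = 2"
    and simple_generate: "generate G (s ` I) = carrier G"
    and presentation: "xs \<in> lists I \<Longrightarrow> ys \<in> lists I \<Longrightarrow> word_prod G s xs = word_prod G s ys \<Longrightarrow>
      word_cong (\<lambda>i j. ord (s i \<otimes> s j)) I xs ys"

definition cox_length :: "('a, 'b) monoid_scheme \<Rightarrow> 'i set \<Rightarrow> ('i \<Rightarrow> 'a) \<Rightarrow> 'a \<Rightarrow> nat" where
  "cox_length G I s w = (LEAST n. \<exists>xs \<in> lists I. length xs = n \<and> word_prod G s xs = w)"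

definition reduced_word ::
  "('a, 'b) monoid_scheme \<Rightarrow> 'i set \<Rightarrow> ('i \<Rightarrow> 'a) \<Rightarrow> 'i list \<Rightarrow> 'a \<Rightarrow> bool" where
  "reduced_word G I s xs w \<longleftrightarrow>
     xs \<in> lists I \<and> word_prod G s xs = w \<and> length xs = cox_length G I s w"

definition right_order :: "('a, 'b) monoid_scheme \<Rightarrow> 'i set \<Rightarrow> ('i \<Rightarrow> 'a) \<Rightarrow> 'a gorder" where
  "right_order G I s = \<lparr>carrier = carrier G, eq = (=),
     le = (\<lambda>u v. \<exists>xs ys. reduced_word G I s xs u \<and> reduced_word G I s (xs @ ys) v)\<rparr>"

definition left_order :: "('a, 'b) monoid_scheme \<Rightarrow> 'i set \<Rightarrow> ('i \<Rightarrow> 'a) \<Rightarrow> 'a gorder" where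
  "left_order G I s = \<lparr>carrier = carrier G, eq = (=),
     le = (\<lambda>u v. \<exists>xs ys. reduced_word G I s ys u \<and> reduced_word G I s (xs @ ys) v)\<rparr>"


section \<open>Blocks and cutting points\<close>

definition parabolic :: "('a, 'b) monoid_scheme \<Rightarrow> ('i \<Rightarrow> 'a) \<Rightarrow> 'i set \<Rightarrow> 'a set" where
  "parabolic G s J = generate G (s ` J)"

text \<open>\<open>coset_min G I s w K\<close> is \<open>w^K\<close>.\<close>
definition coset_min ::
  "('a, 'b) monoid_scheme \<Rightarrow> 'i set \<Rightarrow> ('i \<Rightarrow> 'a) \<Rightarrow> 'a \<Rightarrow> 'i set \<Rightarrow> 'a" where
  "coset_min G I s w K = (THE v. v \<in> w <#\<^bsub>G\<^esub> parabolic G s K \<and>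
     (\<forall>x \<in> w <#\<^bsub>G\<^esub> parabolic G s K. cox_length G I s v \<le> cox_length G I s x))"

definition right_block ::
  "('a, 'b) monoid_scheme \<Rightarrow> 'i set \<Rightarrow> ('i \<Rightarrow> 'a) \<Rightarrow> 'a \<Rightarrow> 'i set \<Rightarrow> bool" where
  "right_block G I s w K \<longleftrightarrow>
     K \<subseteq> I \<and> (\<exists>J \<subseteq> I. w <#\<^bsub>G\<^esub> parabolic G s K = parabolic G s J #>\<^bsub>G\<^esub> w)"

definition nontrivial_right_block ::
  "('a, 'b) monoid_scheme \<Rightarrow> 'i set \<Rightarrow> ('i \<Rightarrow> 'a) \<Rightarrow> 'a \<Rightarrow> 'i set \<Rightarrow> bool" where
  "nontrivial_right_block G I s w K \<longleftrightarrow> right_block G I s w K \<and> coset_min G I s w K \<noteq> w"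

definition min_blocks ::
  "('a, 'b) monoid_scheme \<Rightarrow> 'i set \<Rightarrow> ('i \<Rightarrow> 'a) \<Rightarrow> 'a \<Rightarrow> 'i set set" where
  "min_blocks G I s w =
     {K. nontrivial_right_block G I s w K \<and> (\<forall>K'. nontrivial_right_block G I s w K' \<longrightarrow> \<not> K' \<subset> K)}"

definition cut_order :: "('a, 'b) monoid_scheme \<Rightarrow> 'i set \<Rightarrow> ('i \<Rightarrow> 'a) \<Rightarrow> 'a gorder" where
  "cut_order G I s = \<lparr>carrier = carrier G, eq = (=),
     le = (\<lambda>v w. \<exists>K. right_block G I s w K \<and> v = coset_min G I s w K)\<rparr>"


section \<open>Order-theoretic notions\<close>

definition interval_order :: "('a, 'b) gorder_scheme \<Rightarrow> 'a \<Rightarrow> 'a \<Rightarrow> ('a, 'b) gorder_scheme" where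
  "interval_order L u w = L\<lparr>carrier := \<lbrace>u..w\<rbrace>\<^bsub>L\<^esub>\<rparr>"

text \<open>
  \<open>P\<close> is a lattice on a subset of \<open>L\<close>, with the induced order, and its binary meets and joins
  are meets and joins in all of \<open>L\<close>.
\<close>
definition sublattice_of :: "('a, 'b) gorder_scheme \<Rightarrow> ('a, 'c) gorder_scheme \<Rightarrow> bool" where
  "sublattice_of P L \<longleftrightarrow> lattice P \<and> carrier P \<subseteq> carrier L \<and>
     (\<forall>x \<in> carrier P. \<forall>y \<in> carrier P.
        (x \<sqsubseteq>\<^bsub>P\<^esub> y \<longleftrightarrow> x \<sqsubseteq>\<^bsub>L\<^esub> y) \<and>
        is_glb L (x \<sqinter>\<^bsub>P\<^esub> y) {x, y} \<and> is_lub L (x \<squnion>\<^bsub>P\<^esub> y) {x, y})"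

definition lower_covers :: "('a, 'b) gorder_scheme \<Rightarrow> 'a \<Rightarrow> 'a set" where
  "lower_covers L w = {v \<in> carrier L. v \<sqsubset>\<^bsub>L\<^esub> w \<and> \<not> (\<exists>x \<in> carrier L. v \<sqsubset>\<^bsub>L\<^esub> x \<and> x \<sqsubset>\<^bsub>L\<^esub> w)}"

text \<open>
  The Moebius function of a finite poset, extended by 0 to non-comparable arguments. The
  condition on \<open>L\<close> makes the recursion well-founded.
\<close>
function moebius :: "('a, 'b) gorder_scheme \<Rightarrow> 'a \<Rightarrow> 'a \<Rightarrow> int" where
  "moebius L u w =
     (if partial_order L \<and> finite (carrier L) \<and> u \<in> carrier L \<and> w \<in> carrier L \<and> u \<sqsubseteq>\<^bsub>L\<^esub> w
      then if u = w then 1 else - (\<Sum>v \<in> {v \<in> carrier L. u \<sqsubseteq>\<^bsub>L\<^esub> v \<and> v \<sqsubset>\<^bsub>L\<^esub> w}. moebius L u v)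
      else 0)"
  by auto
termination
proof (relation "measure (\<lambda>(L, u, w). card {v \<in> carrier L. v \<sqsubset>\<^bsub>L\<^esub> w})", simp, clarsimp)
  fix L :: "('a, 'b) gorder_scheme" and w v
  assume "partial_order L" and fin: "finite (carrier L)"
    and w: "w \<in> carrier L" and v: "v \<in> carrier L" and vw: "v \<sqsubset>\<^bsub>L\<^esub> w"
  interpret partial_order L by fact
  have "{x \<in> carrier L. x \<sqsubset>\<^bsub>L\<^esub> v} \<subset> {x \<in> carrier L. x \<sqsubset>\<^bsub>L\<^esub> w}"
    using w v vw by (auto simp: lless_eq intro: le_trans)
  then show "card {x \<in> carrier L. x \<sqsubset>\<^bsub>L\<^esub> v} < card {x \<in> carrier L. x \<sqsubset>\<^bsub>L\<^esub> w}"
    using fin by (intro psubset_card_mono) auto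
qed

declare moebius.simps [simp del]


section \<open>The meet-semilattice generated by the lower covers\<close>

definition cut_covers :: "('a, 'b) monoid_scheme \<Rightarrow> 'i set \<Rightarrow> ('i \<Rightarrow> 'a) \<Rightarrow> 'a \<Rightarrow> 'a set" where
  "cut_covers G I s w = lower_covers (cut_order G I s) w"

text \<open>The meet of \<open>A\<close> in the interval from 1 to \<open>w\<close>; the empty meet is therefore \<open>w\<close>.\<close>
definition cut_meet :: "('a, 'b) monoid_scheme \<Rightarrow> 'i set \<Rightarrow> ('i \<Rightarrow> 'a) \<Rightarrow> 'a \<Rightarrow> 'a set \<Rightarrow> 'a" where
  "cut_meet G I s w A = \<Sqinter>\<^bsub>interval_order (cut_order G I s) \<one>\<^bsub>G\<^esub> w\<^esub> A"

definition cover_meets :: "('a, 'b) monoid_scheme \<Rightarrow> 'i set \<Rightarrow> ('i \<Rightarrow> 'a) \<Rightarrow> 'a \<Rightarrow> 'a set" where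
  "cover_meets G I s w = cut_meet G I s w ` Pow (cut_covers G I s w)"

definition right_ideal :: "('a, 'b) monoid_scheme \<Rightarrow> 'i set \<Rightarrow> ('i \<Rightarrow> 'a) \<Rightarrow> 'a \<Rightarrow> 'a set" where
  "right_ideal G I s w = \<lbrace>\<one>\<^bsub>G\<^esub>..w\<rbrace>\<^bsub>right_order G I s\<^esub>"

text \<open>The intersection is taken inside the interval of \<open>w\<close>, which is its value for empty \<open>A\<close>.\<close>
definition ideal_Inter :: "('a, 'b) monoid_scheme \<Rightarrow> 'i set \<Rightarrow> ('i \<Rightarrow> 'a) \<Rightarrow> 'a \<Rightarrow> 'a set \<Rightarrow> 'a set" where
  "ideal_Inter G I s w A = right_ideal G I s w \<inter> (\<Inter>u \<in> A. right_ideal G I s u)"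

end

theory Submission
  imports Defs
begin

text \<open>
  Everything is read off from inversion sets. A word in the simple reflections has an associated
  list of reflections, and the parity with which a reflection occurs in it depends on the element
  \<open>w\<close> only, because the defining relations of the group do not change it. The reflections that
  occur an odd number of times form the set \<open>inversions w\<close>. Its cardinality is the length of \<open>w\<close>,
  it determines \<open>w\<close>, and \<open>inversions (u v)\<close> is the symmetric difference of \<open>inversions u\<close> and
  \<open>u (inversions v) u\<inverse>\<close>. Hence \<open>u \<le>\<^sub>R v\<close> means \<open>inversions u \<subseteq> inversions v\<close>, and \<open>u \<le>\<^sub>L v\<close> means the
  same for the inverses (\<open>right_order_iff\<close>, \<open>left_order_iff\<close>).

  Suppose that \<open>w W\<^sub>K = W\<^sub>J w\<close>. The minimal element \<open>w\<^sup>K\<close> of this coset is minimal from both sides,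
  so \<open>inversions (w\<^sup>K) = inversions w - W\<^sub>J\<close> (\<open>inversions_coset_min\<close>), and by inversion of group
  elements the inversions of the inverse of \<open>w\<^sup>K\<close> are those of the inverse of \<open>w\<close> outside \<open>W\<^sub>K\<close>. The right blocks of \<open>w\<close>
  are closed under union and intersection. An element has an inversion in a parabolic subgroup
  \<open>W\<^sub>J\<close> only if one of the \<open>s\<^sub>j\<close> with \<open>j \<in> J\<close> is an inversion; therefore it avoids \<open>W\<^bsub>J \<union> J'\<^esub>\<close> as soon
  as it avoids \<open>W\<^sub>J\<close> and \<open>W\<^bsub>J'\<^esub>\<close>, which makes \<open>w\<^bsup>K \<union> K'\<^esup>\<close> the meet of \<open>w\<^sup>K\<close> and \<open>w\<^bsup>K'\<^esup>\<close> in weak order.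
  Dually \<open>W\<^sub>J \<inter> W\<^bsub>J'\<^esub> = W\<^bsub>J \<inter> J'\<^esub>\<close> makes \<open>w\<^bsup>K \<inter> K'\<^esup>\<close> their join, because its inversion set is the
  union of the inversion sets of \<open>w\<^sup>K\<close> and \<open>w\<^bsup>K'\<^esup>\<close>. The same facts give transitivity,
  and show that below \<open>w\<close> the cutting order is the restriction of weak order (\<open>cut_iff_right\<close>), so
  that intervals are sublattices.

  A block is nontrivial if and only if it contains a right descent of \<open>w\<close>. The intersection of two
  distinct minimal nontrivial blocks is a trivial block, so each of them owns a descent that lies in no
  other (\<open>min_block_own_descent\<close>). These private descents show that different sets of minimal
  blocks have different unions and different cutting points, which is the freeness of the
  semilattice of meets of lower covers.

  In any finite poset in which different sets of lower covers of \<open>w\<close> have different meets, signs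
  by the number of covers solve the equations dual to the recursion of the Moebius function,
  because an alternating sum over all subsets of a nonempty set vanishes; such a solution is unique
  (\<open>moebius_cover_meets\<close>).
\<close>

section \<open>Words and reflections\<close>

context coxeter_system
begin

abbreviation wp :: "'i list \<Rightarrow> 'a" where "wp \<equiv> word_prod G s"
abbreviation par :: "'i set \<Rightarrow> 'a set" where "par \<equiv> parabolic G s"
abbreviation len :: "'a \<Rightarrow> nat" where "len \<equiv> cox_length G I s"

lemma inv_mult_cancel [simp]:
  assumes "x \<in> carrier G" "y \<in> carrier G"
  shows "inv x \<otimes> (x \<otimes> y) = y" "x \<otimes> (inv x \<otimes> y) = y"
  using assms by (simp_all flip: m_assoc)

lemma simple_in_carrier [simp]: "i \<in> I \<Longrightarrow> s i \<in> carrier G"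
  using simple_closed by auto

lemma simple_square [simp]: "i \<in> I \<Longrightarrow> s i \<otimes> s i = \<one>"
  using pow_ord_eq_1[of "s i"] simple_ord[of i] by (simp add: numeral_2_eq_2)

lemma inv_simple [simp]: "i \<in> I \<Longrightarrow> inv (s i) = s i"
  using inv_equality[of "s i" "s i"] by simp

lemma simple_cancel [simp]: "i \<in> I \<Longrightarrow> x \<in> carrier G \<Longrightarrow> s i \<otimes> (s i \<otimes> x) = x"
  by (simp flip: m_assoc)

lemma wp_Nil [simp]: "wp [] = \<one>"
  and wp_Cons [simp]: "wp (i # xs) = s i \<otimes> wp xs"
  by (simp_all add: word_prod_def)

lemma wp_closed [simp]: "xs \<in> lists I \<Longrightarrow> wp xs \<in> carrier G"
  by (induction xs) auto

lemma wp_append [simp]: "xs \<in> lists I \<Longrightarrow> ys \<in> lists I \<Longrightarrow> wp (xs @ ys) = wp xs \<otimes> wp ys"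
  by (induction xs) (auto simp: m_assoc)

lemma inv_wp: "xs \<in> lists I \<Longrightarrow> inv (wp xs) = wp (rev xs)"
proof (induction xs)
  case (Cons i xs)
  then have "i \<in> I" "xs \<in> lists I" "rev xs \<in> lists I" by (auto simp: in_lists_conv_set)
  then show ?case using Cons.IH by (simp add: inv_mult_group)
qed simp

lemma parabolic_eq_words:
  assumes "J \<subseteq> I" shows "par J = wp ` lists J"
proof
  show "par J \<subseteq> wp ` lists J"
  proof
    fix x assume "x \<in> par J"
    then have "x \<in> generate G (s ` J)" by (simp add: parabolic_def)
    then show "x \<in> wp ` lists J"
    proof induction
      case one
      show ?case by (rule image_eqI[of _ _ "[]"]) auto
    next
      case (incl h)
      then obtain j where "j \<in> J" "h = s j" by auto
      then show ?case using assms by (intro image_eqI[of _ _ "[j]"]) auto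
    next
      case (inv h)
      then obtain j where "j \<in> J" "h = s j" by auto
      then show ?case using assms by (intro image_eqI[of _ _ "[j]"]) auto
    next
      case (eng g h)
      then obtain xs ys where "xs \<in> lists J" "ys \<in> lists J" "g = wp xs" "h = wp ys" by auto
      moreover have "xs \<in> lists I" "ys \<in> lists I" using calculation assms by auto
      ultimately show ?case by (intro image_eqI[of _ _ "xs @ ys"]) auto
    qed
  qed
  have "wp xs \<in> par J" if "xs \<in> lists J" for xs
    using that
      by (induction xs) (auto simp: parabolic_def intro: generate.one generate.eng generate.incl)
  then show "wp ` lists J \<subseteq> par J" by auto
qed

lemma carrier_eq_words: "carrier G = wp ` lists I"
  using parabolic_eq_words[of I] by (simp add: parabolic_def simple_generate)

lemma subgroup_parabolic: "J \<subseteq> I \<Longrightarrow> subgroup (par J) G"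
  unfolding parabolic_def by (rule generate_is_subgroup) auto

lemma parabolic_carrier: "J \<subseteq> I \<Longrightarrow> x \<in> par J \<Longrightarrow> x \<in> carrier G"
  by (rule subgroup.mem_carrier[OF subgroup_parabolic])

lemma parabolic_mult: "J \<subseteq> I \<Longrightarrow> x \<in> par J \<Longrightarrow> y \<in> par J \<Longrightarrow> x \<otimes> y \<in> par J"
  by (rule subgroup.m_closed[OF subgroup_parabolic])

lemma parabolic_inv: "J \<subseteq> I \<Longrightarrow> x \<in> par J \<Longrightarrow> inv x \<in> par J"
  by (rule subgroup.m_inv_closed[OF subgroup_parabolic])

lemma parabolic_one: "\<one> \<in> par J"
  by (simp add: parabolic_def generate.one)

lemma parabolic_simple: "j \<in> J \<Longrightarrow> s j \<in> par J"
  by (simp add: parabolic_def generate.incl)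

lemma parabolic_mono: "J \<subseteq> K \<Longrightarrow> par J \<subseteq> par K"
  unfolding parabolic_def by (intro mono_generate) auto

text \<open>
  For a word \<open>s\<^sub>1 \<dots> s\<^sub>n\<close> these are the elements \<open>s\<^sub>1 \<dots> s\<^bsub>k-1\<^esub> s\<^sub>k s\<^bsub>k-1\<^esub> \<dots> s\<^sub>1\<close>: multiplication by the
  \<open>k\<close>-th one from the left deletes the \<open>k\<close>-th letter of the word.
\<close>

primrec reflections :: "'i list \<Rightarrow> 'a list" where
  "reflections [] = []"
| "reflections (i # xs) = s i # map (\<lambda>t. s i \<otimes> t \<otimes> inv (s i)) (reflections xs)"

lemma reflections_in_parabolic: "J \<subseteq> I \<Longrightarrow> xs \<in> lists J \<Longrightarrow> set (reflections xs) \<subseteq> par J"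
proof (induction xs)
  case (Cons i xs)
  then have i: "s i \<in> par J" "i \<in> I" and IH: "\<forall>t\<in>set (reflections xs). t \<in> par J"
    by (auto intro: parabolic_simple)
  then have "\<forall>t\<in>set (reflections xs). s i \<otimes> t \<otimes> inv (s i) \<in> par J"
    using parabolic_mult[OF Cons.prems(1)] by simp
  then show ?case using i by auto
qed simp

lemma reflections_closed: "xs \<in> lists I \<Longrightarrow> set (reflections xs) \<subseteq> carrier G"
  using reflections_in_parabolic[of I xs] parabolic_carrier by auto

lemma length_reflections [simp]: "length (reflections xs) = length xs"
  by (induction xs) auto

lemma reflections_append:
  "xs \<in> lists I \<Longrightarrow> ys \<in> lists I \<Longrightarrow>
    reflections (xs @ ys) = reflections xs @ map (\<lambda>t. wp xs \<otimes> t \<otimes> inv (wp xs)) (reflections ys)"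
proof (induction xs)
  case Nil
  then show ?case using reflections_closed[of ys] by (auto intro!: map_idI[symmetric])
next
  case (Cons i xs)
  then have "i \<in> I" "xs \<in> lists I" by auto
  moreover have "\<forall>t\<in>set (reflections ys). t \<in> carrier G"
    using reflections_closed[of ys] Cons.prems by blast
  ultimately show ?case using Cons.IH Cons.prems by (simp add: inv_mult_group m_assoc)
qed

lemma conj_eq_iff:
  assumes "g \<in> carrier G" "t \<in> carrier G" "u \<in> carrier G"
  shows "g \<otimes> t \<otimes> inv g = u \<longleftrightarrow> t = inv g \<otimes> u \<otimes> g"
proof
  assume "g \<otimes> t \<otimes> inv g = u"
  then show "t = inv g \<otimes> u \<otimes> g" using assms by (auto simp: m_assoc)
next
  assume "t = inv g \<otimes> u \<otimes> g"
  then show "g \<otimes> t \<otimes> inv g = u" using assms by (simp add: m_assoc)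
qed

lemma count_list_conj:
  assumes "g \<in> carrier G" "t \<in> carrier G" "set ts \<subseteq> carrier G"
  shows "count_list (map (\<lambda>t. g \<otimes> t \<otimes> inv g) ts) t = count_list ts (inv g \<otimes> t \<otimes> g)"
  using assms(3)
proof (induction ts)
  case (Cons a ts)
  then show ?case using conj_eq_iff[of g a t] assms(1,2) by simp
qed simp

lemma conj_power_mult:
  assumes p: "p \<in> carrier G" and x: "x \<in> carrier G" and px: "x \<otimes> inv p = p \<otimes> x"
  shows "p \<otimes> (p [^] k \<otimes> x) \<otimes> inv p = p [^] (k + (2::nat)) \<otimes> x"
proof -
  have "p \<otimes> (p [^] k \<otimes> x) \<otimes> inv p = (p \<otimes> p [^] k) \<otimes> (x \<otimes> inv p)"
    using p x by (simp add: m_assoc)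
  also have "p \<otimes> p [^] k = p [^] Suc k"
    by (rule nat_pow_Suc2[OF p, symmetric])
  also have "p [^] Suc k \<otimes> (x \<otimes> inv p) = p [^] (k + 2) \<otimes> x"
    unfolding px using p x by (simp add: m_assoc)
  finally show ?thesis .
qed

text \<open>
  The reflections of the relator word are successive powers of \<open>s\<^sub>i s\<^sub>j\<close> times \<open>s\<^sub>i\<close>. Over a word of
  \<open>2m\<close> letters, where \<open>m\<close> is the order of \<open>s\<^sub>i s\<^sub>j\<close>, each of them is therefore met an even number of
  times.
\<close>

lemma reflections_relator:
  assumes i: "i \<in> I" and j: "j \<in> I"
  shows "reflections (concat (replicate n [i, j])) = map (\<lambda>k. (s i \<otimes> s j) [^] k \<otimes> s i) [0..<2 * n]"
proof (induction n)
  case (Suc n)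
  let ?p = "s i \<otimes> s j"
  let ?w = "concat (replicate n [i, j])"
  have w: "?w \<in> lists I" using i j by (induction n) auto
  \<comment> \<open>The simple reflection \<open>s\<^sub>i\<close> inverts the rotation \<open>p\<close>, so that conjugation by \<open>p\<close> raises the exponent by 2.\<close>
  have "s i \<otimes> inv ?p = ?p \<otimes> s i" using i j by (simp add: inv_mult_group m_assoc)
  then have step: "?p \<otimes> (?p [^] k \<otimes> s i) \<otimes> inv ?p = ?p [^] (k + 2) \<otimes> s i" for k :: nat
    using i j by (intro conj_power_mult) auto
  have "reflections (concat (replicate (Suc n) [i, j])) =
      reflections [i, j] @ map (\<lambda>t. wp [i, j] \<otimes> t \<otimes> inv (wp [i, j])) (reflections ?w)"
    using reflections_append[of "[i, j]" ?w] i j w by simp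
  also have "\<dots> = [s i, ?p \<otimes> s i] @ map (\<lambda>k. ?p [^] (k + 2) \<otimes> s i) [0..<2 * n]"
    using i j Suc.IH by (simp add: step)
  also have "\<dots> = map (\<lambda>k. ?p [^] k \<otimes> s i) ([0, 1] @ map (\<lambda>k. k + 2) [0..<2 * n])"
    using i j by simp
  also have "[0, 1] @ map (\<lambda>k. k + 2) [0..<2 * n] = [0..<2 * Suc n]"
    using map_add_upt[of 2 "2 * n"] by (simp add: upt_conv_Cons numeral_2_eq_2 del: upt_Suc)
  finally show ?case .
qed simp

lemma even_count_relator:
  assumes i: "i \<in> I" and j: "j \<in> I"
  shows "even (count_list (reflections (concat (replicate (ord (s i \<otimes> s j)) [i, j]))) t)"
proof -
  let ?p = "s i \<otimes> s j" let ?m = "ord ?p"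
  let ?f = "\<lambda>k::nat. ?p [^] k \<otimes> s i"
  have p: "?p \<in> carrier G" using i j by simp
  have "[0..<2 * ?m] = [0..<?m] @ map (\<lambda>k. k + ?m) [0..<?m]"
    using upt_add_eq_append[of 0 ?m ?m] map_add_upt[of ?m ?m] by (simp add: mult_2)
  moreover have "map ?f (map (\<lambda>k. k + ?m) [0..<?m]) = map ?f [0..<?m]"
    using p by (simp add: nat_pow_mult[symmetric])
  ultimately have "map ?f [0..<2 * ?m] = map ?f [0..<?m] @ map ?f [0..<?m]" by simp
  then show ?thesis by (simp add: reflections_relator[OF i j])
qed

lemma wp_relator: "i \<in> I \<Longrightarrow> j \<in> I \<Longrightarrow> wp (concat (replicate n [i, j])) = (s i \<otimes> s j) [^] n"
proof (induction n)
  case (Suc n)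
  have "(s i \<otimes> s j) [^] Suc n = s i \<otimes> s j \<otimes> (s i \<otimes> s j) [^] n"
    using Suc.prems by (intro nat_pow_Suc2) auto
  then show ?case using Suc by (simp add: m_assoc)
qed simp

text \<open>
  Inserting a relator conjugates and inserts its own list of reflections, which is even, and leaves
  the conjugation of the remaining list unchanged because the relator has product 1.
\<close>

lemma word_cong_parity:
  assumes "word_cong (\<lambda>i j. ord (s i \<otimes> s j)) I xs ys" "t \<in> carrier G"
  shows "even (count_list (reflections xs) t + count_list (reflections ys) t)"
  using assms
proof (induction arbitrary: t)
  case (trans xs ys zs)
  have "even (count_list (reflections xs) t + count_list (reflections ys) t)"
    "even (count_list (reflections ys) t + count_list (reflections zs) t)"
    using trans by auto
  then show ?case by (simp add: even_add)
next
  case (relator xs ys i j)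
  let ?r = "concat (replicate (ord (s i \<otimes> s j)) [i, j])"
  have r: "?r \<in> lists I" using relator by (auto simp: set_replicate_conv_if split: if_splits)
  have wr: "wp ?r = \<one>" using relator by (simp add: wp_relator)
  have id: "map (\<lambda>t. \<one> \<otimes> t \<otimes> inv \<one>) (reflections ys) = reflections ys"
    using reflections_closed[OF relator(2)] by (intro map_idI) auto
  have ry: "reflections (?r @ ys) = reflections ?r @ reflections ys"
    using reflections_append[OF r relator(2)] wr id by simp
  have "?r @ ys \<in> lists I" using r relator by simp
  then have "reflections (xs @ ?r @ ys) = reflections xs @
      map (\<lambda>t. wp xs \<otimes> t \<otimes> inv (wp xs)) (reflections ?r) @
      map (\<lambda>t. wp xs \<otimes> t \<otimes> inv (wp xs)) (reflections ys)"
    using reflections_append[OF relator(1), of "?r @ ys"] ry by simp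
  moreover have "count_list (map (\<lambda>t. wp xs \<otimes> t \<otimes> inv (wp xs)) (reflections ?r)) t =
      count_list (reflections ?r) (inv (wp xs) \<otimes> t \<otimes> wp xs)"
    using relator r by (intro count_list_conj reflections_closed) auto
  ultimately show ?case
    using even_count_relator[OF relator(3,4)] reflections_append[OF relator(1,2)]
    by (simp add: even_add)
qed (auto simp: add.commute)

section \<open>Inversion sets\<close>

text \<open>
  The choice of the word does not matter, by the presentation of the group. With parities instead
  of lengths no reducedness is needed, which makes the product formula \<open>inversions_mult\<close> immediate.
\<close>

definition inversions :: "'a \<Rightarrow> 'a set" where
  "inversions w = {t. odd (count_list (reflections (SOME xs. xs \<in> lists I \<and> wp xs = w)) t)}"

lemma inversions_wp:
  assumes "xs \<in> lists I"
  shows "inversions (wp xs) = {t. odd (count_list (reflections xs) t)}"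
proof -
  define ys where "ys = (SOME ys. ys \<in> lists I \<and> wp ys = wp xs)"
  have ys: "ys \<in> lists I" "wp ys = wp xs"
    using someI[of "\<lambda>ys. ys \<in> lists I \<and> wp ys = wp xs" xs] assms unfolding ys_def by auto
  have cong: "word_cong (\<lambda>i j. ord (s i \<otimes> s j)) I ys xs"
    using presentation ys assms by simp
  have "odd (count_list (reflections ys) t) = odd (count_list (reflections xs) t)" for t
  proof (cases "t \<in> carrier G")
    case True
    then show ?thesis using word_cong_parity[OF cong] by (simp add: even_add)
  next
    case False
    then have "count_list (reflections ys) t = 0" "count_list (reflections xs) t = 0"
      using reflections_closed ys(1) assms by (auto simp: count_list_0_iff)
    then show ?thesis by simp
  qed
  then show ?thesis by (simp add: inversions_def ys_def)
qed

lemma inversions_wp_subset: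
  assumes "xs \<in> lists I" shows "inversions (wp xs) \<subseteq> set (reflections xs)"
proof
  fix t assume "t \<in> inversions (wp xs)"
  then have "count_list (reflections xs) t \<noteq> 0"
    using assms by (auto simp: inversions_wp intro!: Nat.gr0I)
  then show "t \<in> set (reflections xs)" by (simp add: count_list_0_iff)
qed

lemma wordE:
  assumes "w \<in> carrier G" obtains xs where "xs \<in> lists I" "w = wp xs"
  using assms carrier_eq_words by auto

lemma inversions_in_parabolic:
  assumes "J \<subseteq> I" "w \<in> par J" shows "inversions w \<subseteq> par J"
proof -
  obtain xs where xs: "xs \<in> lists J" "w = wp xs" using assms parabolic_eq_words by auto
  then have "xs \<in> lists I" using assms by auto
  then have "inversions w \<subseteq> set (reflections xs)"
    using xs inversions_wp_subset by simp
  then show ?thesis using reflections_in_parabolic[OF assms(1) xs(1)] by simp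
qed

lemma inversions_closed: "w \<in> carrier G \<Longrightarrow> inversions w \<subseteq> carrier G"
  using inversions_in_parabolic[of I w] by (simp add: parabolic_def simple_generate)

lemma inversions_mult:
  assumes "u \<in> carrier G" "v \<in> carrier G" "t \<in> carrier G"
  shows "t \<in> inversions (u \<otimes> v) \<longleftrightarrow> (t \<in> inversions u) \<noteq> (inv u \<otimes> t \<otimes> u \<in> inversions v)"
proof -
  obtain xs ys where xs: "xs \<in> lists I" "u = wp xs" and ys: "ys \<in> lists I" "v = wp ys"
    using assms wordE by metis
  have "u \<otimes> v = wp (xs @ ys)" using xs ys by simp
  moreover have "count_list (map (\<lambda>t. u \<otimes> t \<otimes> inv u) (reflections ys)) t =
      count_list (reflections ys) (inv u \<otimes> t \<otimes> u)"
    using assms reflections_closed ys by (intro count_list_conj) auto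
  ultimately show ?thesis
    using xs ys inversions_wp[of "xs @ ys"] by (auto simp: reflections_append inversions_wp)
qed

lemma inversions_one [simp]: "inversions \<one> = {}"
  using inversions_wp[of "[]"] by simp

lemma inversions_inv:
  assumes "u \<in> carrier G" "t \<in> carrier G"
  shows "t \<in> inversions (inv u) \<longleftrightarrow> u \<otimes> t \<otimes> inv u \<in> inversions u"
  using inversions_mult[of "inv u" u t] assms by auto

text \<open>
  Conjugation by \<open>u\<close> carries the inversions of \<open>u\<inverse> v\<close> to the symmetric difference of those of \<open>u\<close> and
  \<open>v\<close>. Counting it compares the lengths of \<open>u\<close>, \<open>v\<close> and \<open>u\<inverse> v\<close>.
\<close>

lemma inversions_quotient:
  assumes "u \<in> carrier G" "v \<in> carrier G" "t \<in> carrier G"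
  shows "t \<in> inversions (inv u \<otimes> v) \<longleftrightarrow>
    (u \<otimes> t \<otimes> inv u \<in> inversions u) \<noteq> (u \<otimes> t \<otimes> inv u \<in> inversions v)"
  using inversions_mult[of "inv u" v t] inversions_inv[of u t] assms by auto

text \<open>
  The deletion half of the strong exchange condition.
\<close>

lemma reflection_deletes_letter:
  assumes "xs \<in> lists I" "t \<in> set (reflections xs)"
  shows "\<exists>ys \<in> lists (set xs). Suc (length ys) = length xs \<and> t \<otimes> wp xs = wp ys"
  using assms
proof (induction xs arbitrary: t rule: list.induct)
  case (Cons i xs)
  then have i: "i \<in> I" and xs: "xs \<in> lists I" by auto
  from Cons.prems consider "t = s i"
    | t' where "t' \<in> set (reflections xs)" "t = s i \<otimes> t' \<otimes> inv (s i)" by auto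
  then show ?case
  proof cases
    case 1
    then show ?thesis using i xs by (intro bexI[of _ xs]) (auto simp: m_assoc)
  next
    case 2
    then obtain ys where ys: "ys \<in> lists (set xs)" "Suc (length ys) = length xs" "t' \<otimes> wp xs = wp ys"
      using Cons.IH[OF xs] by blast
    have "t' \<in> carrier G" using 2 reflections_closed[OF xs] by auto
    then have "t \<otimes> wp (i # xs) = s i \<otimes> wp ys"
      using 2 i xs by (simp add: m_assoc ys(3)[symmetric])
    then show ?thesis using ys by (intro bexI[of _ "i # ys"]) auto
  qed
qed simp

text \<open>
  If a reflection occurs at two places, multiplying by it twice deletes both letters and does not
  change the product.
\<close>

lemma repeated_reflection_shortens:
  assumes "xs \<in> lists I" "\<not> distinct (reflections xs)"
  shows "\<exists>ys \<in> lists (set xs). length ys < length xs \<and> wp xs = wp ys"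
  using assms
proof (induction xs rule: list.induct)
  case (Cons i xs)
  then have i: "i \<in> I" and xs: "xs \<in> lists I" by auto
  show ?case
  proof (cases "distinct (reflections xs)")
    case False
    then obtain ys where "ys \<in> lists (set xs)" "length ys < length xs" "wp xs = wp ys"
      using Cons.IH xs by blast
    then show ?thesis by (intro bexI[of _ "i # ys"]) auto
  next
    case True
    have inj: "inj_on (\<lambda>t. s i \<otimes> t \<otimes> inv (s i)) (set (reflections xs))"
      using i reflections_closed[OF xs] by (auto intro!: inj_onI simp: subset_iff)
    have "s i \<in> (\<lambda>t. s i \<otimes> t \<otimes> inv (s i)) ` set (reflections xs)"
      using Cons.prems True inj by (auto simp: distinct_map)
    then obtain t where t: "t \<in> set (reflections xs)" "s i \<otimes> t \<otimes> inv (s i) = s i" by auto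
    then have "t = s i"
      using conj_eq_iff[of "s i" t "s i"] i reflections_closed[OF xs] by auto
    then obtain ys where "ys \<in> lists (set xs)" "Suc (length ys) = length xs" "s i \<otimes> wp xs = wp ys"
      using reflection_deletes_letter[OF xs t(1)] by blast
    then show ?thesis by (intro bexI[of _ ys]) auto
  qed
qed simp

text \<open>
  Words over \<open>J\<close> stay over \<open>J\<close> when letters are deleted. A shortest word over \<open>J\<close> thus has no repeated
  reflection, which makes it reduced in the whole group.
\<close>

lemma parabolic_reduced_word:
  assumes "J \<subseteq> I" "w \<in> par J"
  obtains xs where "xs \<in> lists J" "wp xs = w" "distinct (reflections xs)"
proof -
  define P where "P xs \<longleftrightarrow> xs \<in> lists J \<and> wp xs = w" for xs
  have ex: "\<exists>xs. P xs" using assms parabolic_eq_words unfolding P_def by auto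
  define xs where "xs = arg_min length P"
  have xs: "P xs" and min: "P ys \<Longrightarrow> length xs \<le> length ys" for ys
    using ex arg_min_nat_lemma[of P _ length] unfolding xs_def by auto
  have "distinct (reflections xs)"
  proof (rule ccontr)
    assume "\<not> distinct (reflections xs)"
    then obtain ys where "ys \<in> lists (set xs)" "length ys < length xs" "wp xs = wp ys"
      using repeated_reflection_shortens xs assms(1) unfolding P_def by blast
    then show False using min[of ys] xs unfolding P_def by auto
  qed
  then show ?thesis using that xs unfolding P_def by blast
qed

lemma inversions_reduced:
  assumes "xs \<in> lists I" "distinct (reflections xs)"
  shows "inversions (wp xs) = set (reflections xs)"
proof -
  have "count_list ts t = (if t \<in> set ts then 1 else 0)" if "distinct ts" for ts :: "'a list" and t
    using that by (induction ts) auto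
  then show ?thesis using assms by (simp add: inversions_wp split: if_splits)
qed

lemma finite_inversions [simp]:
  assumes "w \<in> carrier G" shows "finite (inversions w)"
proof -
  obtain xs where xs: "xs \<in> lists I" "w = wp xs" using assms wordE by auto
  then have "inversions w \<subseteq> set (reflections xs)"
    using inversions_wp_subset by simp
  then show ?thesis using finite_subset by blast
qed

lemma card_inversions_le:
  assumes "xs \<in> lists I" shows "card (inversions (wp xs)) \<le> length xs"
proof -
  have "inversions (wp xs) \<subseteq> set (reflections xs)"
    using assms by (rule inversions_wp_subset)
  then have "card (inversions (wp xs)) \<le> card (set (reflections xs))" by (simp add: card_mono)
  also have "\<dots> \<le> length xs" using card_length[of "reflections xs"] by simp
  finally show ?thesis .
qed

lemma len_eq_card_inversions:
  assumes "w \<in> carrier G" shows "len w = card (inversions w)"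
proof -
  have "w \<in> par I" using assms by (simp add: parabolic_def simple_generate)
  then obtain xs where xs: "xs \<in> lists I" "wp xs = w" "distinct (reflections xs)"
    using parabolic_reduced_word[of I w] by auto
  have "card (inversions w) = length xs"
    using xs inversions_reduced[of xs] distinct_card[of "reflections xs"] by simp
  moreover have "card (inversions w) \<le> n" if ex: "\<exists>ys\<in>lists I. length ys = n \<and> wp ys = w" for n
  proof -
    obtain ys where "ys \<in> lists I" "length ys = n" "wp ys = w" using ex by blast
    then show ?thesis using card_inversions_le[of ys] by simp
  qed
  ultimately show ?thesis unfolding cox_length_def
    using xs(1,2) by (intro Least_equality bexI[of _ xs]) simp_all
qed

lemma reduced_word_iff:
  "reduced_word G I s xs w \<longleftrightarrow> xs \<in> lists I \<and> wp xs = w \<and> distinct (reflections xs)"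
proof -
  have "distinct (reflections xs)" if "xs \<in> lists I" "length xs = len (wp xs)"
  proof -
    have "inversions (wp xs) \<subseteq> set (reflections xs)"
      using that by (intro inversions_wp_subset)
    then have "length xs \<le> card (set (reflections xs))"
      using that by (simp add: len_eq_card_inversions card_mono)
    then show ?thesis
      by (metis card_distinct card_length le_antisym length_reflections)
  qed
  moreover have "length xs = len (wp xs)" if "xs \<in> lists I" "distinct (reflections xs)"
    using that inversions_reduced[of xs] distinct_card[of "reflections xs"]
    by (simp add: len_eq_card_inversions)
  ultimately show ?thesis unfolding reduced_word_def by auto
qed

lemma len_inv:
  assumes "w \<in> carrier G" shows "len (inv w) = len w"
proof -
  have "bij_betw (\<lambda>t. w \<otimes> t \<otimes> inv w) (inversions (inv w)) (inversions w)"
  proof (rule bij_betwI[of _ _ _ "\<lambda>t. inv w \<otimes> t \<otimes> w"])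
    show "(\<lambda>t. w \<otimes> t \<otimes> inv w) \<in> inversions (inv w) \<rightarrow> inversions w"
      using inversions_inv[OF assms] inversions_closed[of "inv w"] assms by auto
    show "(\<lambda>t. inv w \<otimes> t \<otimes> w) \<in> inversions w \<rightarrow> inversions (inv w)"
      using inversions_inv[of "inv w"] inversions_closed[of w] assms by auto
  qed (use assms inversions_closed[of "inv w"] inversions_closed[of w] in \<open>auto simp: m_assoc subset_iff\<close>)
  then show ?thesis using assms by (simp add: len_eq_card_inversions bij_betw_same_card)
qed

lemma inversions_empty_iff:
  assumes "w \<in> carrier G" shows "inversions w = {} \<longleftrightarrow> w = \<one>"
proof
  assume "inversions w = {}"
  moreover obtain xs where "xs \<in> lists I" "wp xs = w" "distinct (reflections xs)"
    using parabolic_reduced_word[of I w] assms by (auto simp: parabolic_def simple_generate)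
  ultimately have "length (reflections xs) = 0" using inversions_reduced[of xs] by auto
  then show "w = \<one>" using \<open>wp xs = w\<close> by simp
qed simp

lemma inversions_inject:
  assumes "u \<in> carrier G" "v \<in> carrier G" "inversions u = inversions v"
  shows "u = v"
proof -
  have "inversions (inv u \<otimes> v) = {}"
    using inversions_quotient[of u v] inversions_closed[of "inv u \<otimes> v"] assms by auto
  then have "inv u \<otimes> v = \<one>" using assms by (simp add: inversions_empty_iff)
  then have "u \<otimes> (inv u \<otimes> v) = u" using assms by simp
  then show ?thesis using assms by simp
qed

text \<open>
  If the inversions of \<open>u\<close> are among those of \<open>v\<close>, the symmetric difference is a difference of sets
  and cardinalities subtract.
\<close>

lemma len_quotient:
  assumes "u \<in> carrier G" "v \<in> carrier G" "inversions u \<subseteq> inversions v"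
  shows "len u + len (inv u \<otimes> v) = len v"
proof -
  have "bij_betw (\<lambda>t. u \<otimes> t \<otimes> inv u) (inversions (inv u \<otimes> v)) (inversions v - inversions u)"
  proof (rule bij_betwI[of _ _ _ "\<lambda>t. inv u \<otimes> t \<otimes> u"])
    show "(\<lambda>t. u \<otimes> t \<otimes> inv u) \<in> inversions (inv u \<otimes> v) \<rightarrow> inversions v - inversions u"
      using inversions_quotient[OF assms(1,2)] inversions_closed[of "inv u \<otimes> v"] assms by auto
    show "(\<lambda>t. inv u \<otimes> t \<otimes> u) \<in> inversions v - inversions u \<rightarrow> inversions (inv u \<otimes> v)"
    proof
      fix t assume t: "t \<in> inversions v - inversions u"
      then have "t \<in> carrier G" using inversions_closed assms by auto
      moreover then have "u \<otimes> (inv u \<otimes> t \<otimes> u) \<otimes> inv u = t" using assms by (simp add: m_assoc)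
      ultimately show "inv u \<otimes> t \<otimes> u \<in> inversions (inv u \<otimes> v)"
        using inversions_quotient[OF assms(1,2), of "inv u \<otimes> t \<otimes> u"] t assms by auto
    qed
  qed (use assms inversions_closed[of "inv u \<otimes> v"] inversions_closed[of v] in \<open>auto simp: m_assoc subset_iff\<close>)
  then have "len (inv u \<otimes> v) = card (inversions v - inversions u)"
    using assms by (simp add: len_eq_card_inversions bij_betw_same_card)
  moreover have "card (inversions u) \<le> card (inversions v)" using assms by (simp add: card_mono)
  ultimately show ?thesis using assms by (simp add: len_eq_card_inversions card_Diff_subset)
qed

lemma reduced_wordE:
  assumes "w \<in> carrier G" obtains xs where "reduced_word G I s xs w"
  using parabolic_reduced_word[of I w] assms
  by (auto simp: parabolic_def simple_generate reduced_word_iff)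

lemma right_order_iff:
  assumes "u \<in> carrier G" "v \<in> carrier G"
  shows "u \<sqsubseteq>\<^bsub>right_order G I s\<^esub> v \<longleftrightarrow> inversions u \<subseteq> inversions v"
proof
  assume "u \<sqsubseteq>\<^bsub>right_order G I s\<^esub> v"
  then obtain xs ys where "reduced_word G I s xs u" "reduced_word G I s (xs @ ys) v"
    by (auto simp: right_order_def)
  then have "xs \<in> lists I" "ys \<in> lists I" "wp xs = u" "distinct (reflections xs)" "wp (xs @ ys) = v"
    "distinct (reflections (xs @ ys))"
    by (auto simp: reduced_word_iff)
  then show "inversions u \<subseteq> inversions v"
    using inversions_reduced[of xs] inversions_reduced[of "xs @ ys"]
    by (auto simp: reflections_append simp del: wp_append)
next
  assume le: "inversions u \<subseteq> inversions v"
  obtain xs where xs: "reduced_word G I s xs u" using reduced_wordE assms by blast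
  obtain ys where ys: "reduced_word G I s ys (inv u \<otimes> v)"
    using reduced_wordE[of "inv u \<otimes> v"] assms by auto
  have "reduced_word G I s (xs @ ys) v"
    using xs ys len_quotient[OF assms le] assms by (auto simp: reduced_word_def)
  then show "u \<sqsubseteq>\<^bsub>right_order G I s\<^esub> v" using xs by (auto simp: right_order_def)
qed

lemma reduced_word_rev: "w \<in> carrier G \<Longrightarrow> reduced_word G I s xs w \<Longrightarrow> reduced_word G I s (rev xs) (inv w)"
  using inv_wp[of xs] len_inv[of w] by (auto simp: reduced_word_def)

lemma left_order_iff_right_order:
  assumes "u \<in> carrier G" "v \<in> carrier G"
  shows "u \<sqsubseteq>\<^bsub>left_order G I s\<^esub> v \<longleftrightarrow> inv u \<sqsubseteq>\<^bsub>right_order G I s\<^esub> inv v"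
proof
  assume "u \<sqsubseteq>\<^bsub>left_order G I s\<^esub> v"
  then obtain xs ys where "reduced_word G I s ys u" "reduced_word G I s (xs @ ys) v"
    by (auto simp: left_order_def)
  then have "reduced_word G I s (rev ys) (inv u)" "reduced_word G I s (rev ys @ rev xs) (inv v)"
    using reduced_word_rev[of u ys] reduced_word_rev[of v "xs @ ys"] assms by auto
  then show "inv u \<sqsubseteq>\<^bsub>right_order G I s\<^esub> inv v" by (auto simp: right_order_def)
next
  assume "inv u \<sqsubseteq>\<^bsub>right_order G I s\<^esub> inv v"
  then obtain xs ys where "reduced_word G I s xs (inv u)" "reduced_word G I s (xs @ ys) (inv v)"
    by (auto simp: right_order_def)
  then have "reduced_word G I s (rev xs) u" "reduced_word G I s (rev ys @ rev xs) v"
    using reduced_word_rev[of "inv u" xs] reduced_word_rev[of "inv v" "xs @ ys"] assms by auto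
  then show "u \<sqsubseteq>\<^bsub>left_order G I s\<^esub> v" by (auto simp: left_order_def)
qed

lemma left_order_iff:
  assumes "u \<in> carrier G" "v \<in> carrier G"
  shows "u \<sqsubseteq>\<^bsub>left_order G I s\<^esub> v \<longleftrightarrow> inversions (inv u) \<subseteq> inversions (inv v)"
  using assms by (simp add: left_order_iff_right_order right_order_iff)

section \<open>Parabolic subgroups\<close>

lemma parabolic_first_letter:
  assumes "J \<subseteq> I" "w \<in> par J" "w \<noteq> \<one>"
  obtains j where "j \<in> J" "s j \<in> inversions w" "len (s j \<otimes> w) < len w"
proof -
  obtain xs where xs: "xs \<in> lists J" "wp xs = w" "distinct (reflections xs)"
    using parabolic_reduced_word assms by metis
  with assms obtain j ys where [simp]: "xs = j # ys" by (cases xs) auto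
  have I: "xs \<in> lists I" using xs assms by auto
  have "s j \<in> inversions w" using inversions_reduced[OF I xs(3)] xs(2) by simp
  moreover have "len (s j \<otimes> w) < len w"
  proof -
    have "j \<in> I" "ys \<in> lists I" using I by auto
    then have "s j \<otimes> w = wp ys" using xs(2) by (simp flip: xs(2))
    then have "len (s j \<otimes> w) \<le> length ys"
      using I card_inversions_le[of ys] by (simp add: len_eq_card_inversions)
    also have "\<dots> < length xs" by simp
    also have "length xs = len w" using xs I by (metis reduced_word_def reduced_word_iff)
    finally show ?thesis .
  qed
  ultimately show ?thesis using that xs by auto
qed

text \<open>
  A reduced word over \<open>J\<close> of \<open>s\<^sub>i\<close> starts with a letter \<open>j\<close> whose reflection \<open>s\<^sub>j\<close> is an inversion of
  \<open>s\<^sub>i\<close>, and \<open>s\<^sub>i\<close> is its own only inversion.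
\<close>

lemma simple_in_parabolic:
  assumes "J \<subseteq> I" "i \<in> I" "s i \<in> par J" shows "i \<in> J"
proof -
  have "s i \<noteq> \<one>" using simple_ord[of i] assms(2) by auto
  then obtain j where j: "j \<in> J" "s j \<in> inversions (s i)"
    using parabolic_first_letter assms by metis
  have "inversions (s i) = {s i}"
    using inversions_reduced[of "[i]"] assms(2) by simp
  then show ?thesis using j simple_inj assms by (auto dest: inj_onD)
qed

text \<open>
  The first letter of a reduced word over \<open>J\<close> is an inversion, and all inversions of an element of
  \<open>W\<^sub>K\<close> lie in \<open>W\<^sub>K\<close>; so the letter is in \<open>J \<inter> K\<close> and can be split off.
\<close>

lemma parabolic_Int:
  assumes "J \<subseteq> I" "K \<subseteq> I" shows "par J \<inter> par K = par (J \<inter> K)"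
proof
  show "par (J \<inter> K) \<subseteq> par J \<inter> par K" using parabolic_mono by auto
  have "w \<in> par (J \<inter> K)" if "w \<in> par J" "w \<in> par K" for w
    using that
  proof (induction "len w" arbitrary: w rule: less_induct)
    case less
    show ?case
    proof (cases "w = \<one>")
      case True then show ?thesis by (simp add: parabolic_one)
    next
      case False
      then obtain j where j: "j \<in> J" "s j \<in> inversions w" "len (s j \<otimes> w) < len w"
        using parabolic_first_letter assms less.prems by metis
      have "s j \<in> par K" using inversions_in_parabolic[OF assms(2)] j less.prems by auto
      then have K: "j \<in> K" using simple_in_parabolic j assms by auto
      have "s j \<otimes> w \<in> par J" "s j \<otimes> w \<in> par K"
        using j(1) K assms less.prems by (auto intro!: parabolic_mult intro: parabolic_simple)
      then have "s j \<otimes> w \<in> par (J \<inter> K)" using less.hyps j by simp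
      then have "s j \<otimes> (s j \<otimes> w) \<in> par (J \<inter> K)"
        using assms j(1) K parabolic_mult[of "J \<inter> K" "s j" "s j \<otimes> w"]
        by (auto intro: parabolic_simple)
      then show ?thesis using j(1) assms less.prems parabolic_carrier[of J w] by auto
    qed
  qed
  then show "par J \<inter> par K \<subseteq> par (J \<inter> K)" by auto
qed

lemma inversion_shortens:
  assumes "w \<in> carrier G" "t \<in> inversions w"
  shows "len (t \<otimes> w) < len w"
proof -
  obtain xs where xs: "xs \<in> lists I" "wp xs = w" "distinct (reflections xs)"
    using parabolic_reduced_word[of I w] assms by (auto simp: parabolic_def simple_generate)
  then obtain ys where ys: "ys \<in> lists (set xs)" "Suc (length ys) = length xs" "t \<otimes> wp xs = wp ys"
    using reflection_deletes_letter[of xs t] inversions_reduced[of xs] assms by auto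
  have I: "ys \<in> lists I" using ys xs by auto
  have "len (t \<otimes> w) \<le> length ys"
    using ys(3) xs(2) I card_inversions_le[of ys] by (simp add: len_eq_card_inversions)
  also have "\<dots> < length xs" using ys by simp
  also have "length xs = len w" using xs by (metis reduced_word_def reduced_word_iff)
  finally show ?thesis .
qed

text \<open>
  The elements \<open>x\<close> without inversions in \<open>W\<^sub>J\<close> are the minimal representatives of the cosets \<open>W\<^sub>J x\<close>.
  An inversion \<open>t\<close> of \<open>a \<in> W\<^sub>J\<close> could be cancelled only by the inversion \<open>a\<inverse> t a\<close> of \<open>x\<close>, which would lie
  in \<open>W\<^sub>J\<close>.
\<close>

lemma inversions_disjoint_parabolic:
  assumes "x \<in> carrier G" "a \<in> par J" "J \<subseteq> I" "inversions x \<inter> par J = {}"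
  shows "inversions a \<subseteq> inversions (a \<otimes> x)"
proof
  fix t assume t: "t \<in> inversions a"
  have a: "a \<in> carrier G" using assms parabolic_carrier by blast
  have "t \<in> par J" using t inversions_in_parabolic assms by auto
  then have "inv a \<otimes> t \<otimes> a \<in> par J" using assms by (intro parabolic_mult parabolic_inv) auto
  then show "t \<in> inversions (a \<otimes> x)"
    using inversions_mult[OF a assms(1), of t] t inversions_closed[OF a] assms(4) by auto
qed

lemma len_mult_disjoint:
  assumes "x \<in> carrier G" "a \<in> par J" "J \<subseteq> I" "inversions x \<inter> par J = {}"
  shows "len (a \<otimes> x) = len a + len x"
proof -
  have a: "a \<in> carrier G" using assms parabolic_carrier by blast
  show ?thesis
    using len_quotient[OF a _ inversions_disjoint_parabolic[OF assms]] a assms(1) by simp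
qed

lemma ex_min_left_coset:
  assumes "x \<in> carrier G" "J \<subseteq> I"
  obtains a where "a \<in> par J" "inversions (a \<otimes> x) \<inter> par J = {}"
proof -
  define P where "P a \<longleftrightarrow> a \<in> par J" for a
  define a where "a = arg_min (\<lambda>a. len (a \<otimes> x)) P"
  have a: "a \<in> par J" and min: "b \<in> par J \<Longrightarrow> len (a \<otimes> x) \<le> len (b \<otimes> x)" for b
    using arg_min_nat_lemma[of P \<one> "\<lambda>a. len (a \<otimes> x)"] parabolic_one[of J]
    unfolding a_def P_def by auto
  have ac: "a \<in> carrier G" using a assms parabolic_carrier by blast
  have "inversions (a \<otimes> x) \<inter> par J = {}"
  proof (rule ccontr)
    assume "inversions (a \<otimes> x) \<inter> par J \<noteq> {}"
    then obtain t where t: "t \<in> inversions (a \<otimes> x)" "t \<in> par J" by auto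
    have "len (t \<otimes> (a \<otimes> x)) < len (a \<otimes> x)"
      using inversion_shortens t(1) ac assms by simp
    moreover have "t \<otimes> (a \<otimes> x) = (t \<otimes> a) \<otimes> x"
      using t(2) parabolic_carrier assms ac by (simp add: m_assoc)
    moreover have "t \<otimes> a \<in> par J" using parabolic_mult t(2) a assms by simp
    ultimately show False using min[of "t \<otimes> a"] by simp
  qed
  then show ?thesis using that a by blast
qed

text \<open>
  Descents detect inversions: write \<open>x\<close> as an element of \<open>W\<^sub>J\<close> times the minimal element of \<open>W\<^sub>J x\<close>.
  If the former is not 1, the first letter of a reduced word for it is an inversion of \<open>x\<close>.
\<close>

lemma parabolic_inversion_descent:
  assumes "x \<in> carrier G" "J \<subseteq> I" "inversions x \<inter> par J \<noteq> {}"
  obtains j where "j \<in> J" "s j \<in> inversions x"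
proof -
  obtain b where b: "b \<in> par J" "inversions (b \<otimes> x) \<inter> par J = {}"
    using ex_min_left_coset assms by metis
  have bc: "b \<in> carrier G" using b assms parabolic_carrier by blast
  have ne: "inv b \<noteq> \<one>" using b assms bc by auto
  have par: "inv b \<in> par J" using parabolic_inv b assms by simp
  obtain j where j: "j \<in> J" "s j \<in> inversions (inv b)"
    using parabolic_first_letter[OF assms(2) par ne] by metis
  have "inversions (inv b) \<subseteq> inversions (inv b \<otimes> (b \<otimes> x))"
    using inversions_disjoint_parabolic[OF _ par assms(2) b(2)] bc assms by simp
  then show ?thesis using that[OF j(1)] j bc assms by auto
qed

text \<open>
  The parabolic subgroup of a union is larger than the union of the parabolic subgroups, but it has
  no further simple reflections, and these decide.
\<close>

lemma inversions_disjoint_UN: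
  assumes "x \<in> carrier G" "\<And>a. a \<in> A \<Longrightarrow> J a \<subseteq> I"
  shows "inversions x \<inter> par (\<Union>a\<in>A. J a) = {} \<longleftrightarrow> (\<forall>a\<in>A. inversions x \<inter> par (J a) = {})"
proof
  assume "inversions x \<inter> par (\<Union>a\<in>A. J a) = {}"
  then show "\<forall>a\<in>A. inversions x \<inter> par (J a) = {}"
    using parabolic_mono[of "J _" "\<Union>a\<in>A. J a"] by blast
next
  assume *: "\<forall>a\<in>A. inversions x \<inter> par (J a) = {}"
  show "inversions x \<inter> par (\<Union>a\<in>A. J a) = {}"
  proof (rule ccontr)
    assume "inversions x \<inter> par (\<Union>a\<in>A. J a) \<noteq> {}"
    then obtain j where "j \<in> (\<Union>a\<in>A. J a)" "s j \<in> inversions x"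
      using parabolic_inversion_descent[of x "\<Union>a\<in>A. J a"] assms by blast
    then show False using * parabolic_simple by blast
  qed
qed

section \<open>Blocks and cutting points\<close>

abbreviation cm :: "'a \<Rightarrow> 'i set \<Rightarrow> 'a" where "cm \<equiv> coset_min G I s"

lemma mem_left_coset:
  assumes "w \<in> carrier G" "K \<subseteq> I"
  shows "x \<in> w <# par K \<longleftrightarrow> x \<in> carrier G \<and> inv w \<otimes> x \<in> par K"
proof
  assume "x \<in> w <# par K"
  then obtain z where "z \<in> par K" "x = w \<otimes> z" by (auto simp: l_coset_def)
  then show "x \<in> carrier G \<and> inv w \<otimes> x \<in> par K"
    using assms parabolic_carrier[of K z] by simp
next
  assume x: "x \<in> carrier G \<and> inv w \<otimes> x \<in> par K"
  then have "x = w \<otimes> (inv w \<otimes> x)" using assms by simp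
  then show "x \<in> w <# par K" using x by (auto simp: l_coset_def)
qed

lemma mem_right_coset:
  assumes "w \<in> carrier G" "J \<subseteq> I"
  shows "x \<in> par J #> w \<longleftrightarrow> x \<in> carrier G \<and> x \<otimes> inv w \<in> par J"
proof
  assume "x \<in> par J #> w"
  then obtain z where "z \<in> par J" "x = z \<otimes> w" by (auto simp: r_coset_def)
  then show "x \<in> carrier G \<and> x \<otimes> inv w \<in> par J"
    using assms parabolic_carrier[of J z] by (simp add: m_assoc)
next
  assume x: "x \<in> carrier G \<and> x \<otimes> inv w \<in> par J"
  then have "x = (x \<otimes> inv w) \<otimes> w" using assms by (simp add: m_assoc)
  then show "x \<in> par J #> w" using x by (auto simp: r_coset_def)
qed

text \<open>
  An element \<open>v\<close> whose inverse has no inversions in \<open>W\<^sub>K\<close> satisfies \<open>\<ell>(v z) = \<ell>(v) + \<ell>(z)\<close> for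
  \<open>z \<in> W\<^sub>K\<close>, so that it is the only shortest element of its coset.
\<close>

lemma coset_min_eqI:
  assumes w: "w \<in> carrier G" and K: "K \<subseteq> I" and v: "v \<in> carrier G" "inv w \<otimes> v \<in> par K"
    and disj: "inversions (inv v) \<inter> par K = {}"
  shows "cm w K = v"
proof -
  have quot: "inv v \<otimes> x \<in> par K \<and> len x = len (inv v \<otimes> x) + len v"
    if "x \<in> w <# par K" for x
  proof -
    have x: "x \<in> carrier G" "inv w \<otimes> x \<in> par K" using that mem_left_coset[OF w K] by auto
    have "inv (inv w \<otimes> v) \<otimes> (inv w \<otimes> x) \<in> par K"
      using parabolic_mult[OF K parabolic_inv[OF K v(2)] x(2)] .
    then have z: "inv v \<otimes> x \<in> par K" using w v x by (simp add: inv_mult_group m_assoc)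
    have "len (inv (inv v \<otimes> x) \<otimes> inv v) = len (inv (inv v \<otimes> x)) + len (inv v)"
      using v len_mult_disjoint[OF _ parabolic_inv[OF K z] K disj] by simp
    moreover have "inv (inv v \<otimes> x) \<otimes> inv v = inv x"
      using v x by (simp add: inv_mult_group m_assoc)
    ultimately show ?thesis using z v x by (simp add: len_inv)
  qed
  have "v \<in> w <# par K" using v mem_left_coset[OF w K] by simp
  show ?thesis unfolding coset_min_def
  proof (rule the_equality)
    show "v \<in> w <# par K \<and> (\<forall>x \<in> w <# par K. len v \<le> len x)"
      using \<open>v \<in> w <# par K\<close> quot[THEN conjunct2] by (metis le_add2)
  next
    fix x assume x: "x \<in> w <# par K \<and> (\<forall>y \<in> w <# par K. len x \<le> len y)"
    then have "len x \<le> len v" using \<open>v \<in> w <# par K\<close> by blast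
    moreover have "len x = len (inv v \<otimes> x) + len v" using quot x by blast
    ultimately have "len (inv v \<otimes> x) = 0" by linarith
    moreover have xc: "x \<in> carrier G" using x mem_left_coset[OF w K] by simp
    ultimately have "inv v \<otimes> x = \<one>"
      using v by (simp add: len_eq_card_inversions inversions_empty_iff)
    then have "v \<otimes> (inv v \<otimes> x) = v" using v by simp
    then show "x = v" using v xc by simp
  qed
qed

lemma coset_min_mem:
  assumes w: "w \<in> carrier G" and K: "K \<subseteq> I"
  shows coset_min_closed: "cm w K \<in> carrier G"
    and coset_min_in_coset: "inv w \<otimes> cm w K \<in> par K"
    and coset_min_disjoint: "inversions (inv (cm w K)) \<inter> par K = {}"
proof -
  obtain a where a: "a \<in> par K" "inversions (a \<otimes> inv w) \<inter> par K = {}"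
    using ex_min_left_coset[of "inv w" K] w K by auto
  have ac: "a \<in> carrier G" using a K parabolic_carrier by simp
  define v where "v = w \<otimes> inv a"
  have v: "v \<in> carrier G" "inv w \<otimes> v \<in> par K" "inversions (inv v) \<inter> par K = {}"
    using a w ac parabolic_inv[OF K a(1)] by (simp_all add: v_def inv_mult_group)
  then have "cm w K = v" using coset_min_eqI[OF w K] by simp
  then show "cm w K \<in> carrier G" "inv w \<otimes> cm w K \<in> par K"
    "inversions (inv (cm w K)) \<inter> par K = {}" using v by simp_all
qed

lemma coset_min_cong:
  assumes "w \<in> carrier G" "v \<in> carrier G" "K \<subseteq> I" "inv w \<otimes> v \<in> par K"
  shows "cm v K = cm w K"
proof (rule coset_min_eqI)
  have "inv (inv w \<otimes> v) \<otimes> (inv w \<otimes> cm w K) \<in> par K"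
    using parabolic_mult[OF assms(3) parabolic_inv[OF assms(3,4)] coset_min_in_coset] assms by simp
  then show "inv v \<otimes> cm w K \<in> par K"
    using assms coset_min_closed by (simp add: inv_mult_group m_assoc)
qed (use assms in \<open>auto simp: coset_min_closed coset_min_disjoint\<close>)

text \<open>
  A right block \<open>K\<close> together with the corresponding left block \<open>J\<close>. With both sets in view, passing
  to the inverse of \<open>w\<close> just exchanges them (\<open>block_inv\<close>), and each fact about right order yields one
  about left order.
\<close>

definition block :: "'a \<Rightarrow> 'i set \<Rightarrow> 'i set \<Rightarrow> bool" where
  "block w J K \<longleftrightarrow> w \<in> carrier G \<and> J \<subseteq> I \<and> K \<subseteq> I \<and> w <# par K = par J #> w"

lemma blockD:
  assumes "block w J K" shows "w \<in> carrier G" "J \<subseteq> I" "K \<subseteq> I" "w <# par K = par J #> w"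
  using assms by (auto simp: block_def)

lemma right_block_iff: "w \<in> carrier G \<Longrightarrow> right_block G I s w K \<longleftrightarrow> (\<exists>J. block w J K)"
  by (auto simp: right_block_def block_def)

lemma block_iff_conj:
  assumes w: "w \<in> carrier G" and J: "J \<subseteq> I" and K: "K \<subseteq> I"
  shows "block w J K \<longleftrightarrow> (\<forall>x\<in>par K. w \<otimes> x \<otimes> inv w \<in> par J) \<and> (\<forall>y\<in>par J. inv w \<otimes> y \<otimes> w \<in> par K)"
    (is "_ \<longleftrightarrow> ?A \<and> ?B")
proof
  assume "block w J K"
  then have eq: "x \<in> w <# par K \<longleftrightarrow> x \<in> par J #> w" for x by (simp add: block_def)
  show "?A \<and> ?B"
  proof (intro conjI ballI)
    fix x assume x: "x \<in> par K"
    then have xc: "x \<in> carrier G" using parabolic_carrier K by simp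
    have "w \<otimes> x \<in> w <# par K" using x xc w by (simp add: mem_left_coset[OF w K])
    then have "w \<otimes> x \<in> par J #> w" by (simp only: eq)
    then show "w \<otimes> x \<otimes> inv w \<in> par J" by (simp add: mem_right_coset[OF w J])
  next
    fix y assume y: "y \<in> par J"
    then have yc: "y \<in> carrier G" using parabolic_carrier J by simp
    have "y \<otimes> w \<in> par J #> w" using y yc w by (simp add: mem_right_coset[OF w J] m_assoc)
    then have "y \<otimes> w \<in> w <# par K" by (simp only: eq)
    then have "inv w \<otimes> (y \<otimes> w) \<in> par K" by (simp add: mem_left_coset[OF w K])
    then show "inv w \<otimes> y \<otimes> w \<in> par K" using yc w by (simp add: m_assoc)
  qed
next
  assume AB: "?A \<and> ?B"
  have "x \<in> w <# par K \<longleftrightarrow> x \<in> par J #> w" for x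
  proof (cases "x \<in> carrier G")
    case x: True
    have "inv w \<otimes> x \<in> par K \<longleftrightarrow> x \<otimes> inv w \<in> par J"
    proof
      assume "inv w \<otimes> x \<in> par K"
      then have "w \<otimes> (inv w \<otimes> x) \<otimes> inv w \<in> par J" using AB by blast
      then show "x \<otimes> inv w \<in> par J" using w x by simp
    next
      assume "x \<otimes> inv w \<in> par J"
      then have "inv w \<otimes> (x \<otimes> inv w) \<otimes> w \<in> par K" using AB by blast
      then show "inv w \<otimes> x \<in> par K" using w x by (simp add: m_assoc)
    qed
    then show ?thesis using x by (simp add: mem_left_coset[OF w K] mem_right_coset[OF w J])
  qed (simp add: mem_left_coset[OF w K] mem_right_coset[OF w J])
  then show "block w J K" using assms by (auto simp: block_def)
qed

lemma block_conj:
  assumes "block w J K"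
  shows "x \<in> par K \<Longrightarrow> w \<otimes> x \<otimes> inv w \<in> par J" "y \<in> par J \<Longrightarrow> inv w \<otimes> y \<otimes> w \<in> par K"
  using block_iff_conj[of w J K] blockD[OF assms] assms by simp_all

lemma block_inv: "block w J K \<Longrightarrow> block (inv w) K J"
  using block_iff_conj[of w J K] block_iff_conj[of "inv w" K J] blockD[of w J K] by simp

text \<open>
  Whether \<open>K\<close> is a block depends on the coset only; in particular the block of \<open>w\<close> is one of \<open>w\<^sup>K\<close>.
\<close>

lemma block_translate:
  assumes b: "block w J K" and v: "v \<in> carrier G" "inv w \<otimes> v \<in> par K"
  shows "block v J K"
proof -
  note [simp] = blockD(1)[OF b] and K = blockD(3)[OF b] and J = blockD(2)[OF b]
  define z where "z = inv w \<otimes> v"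
  have z: "z \<in> par K" "z \<in> carrier G" using v by (simp_all add: z_def)
  have vz: "v = w \<otimes> z" using v by (simp add: z_def)
  have "v \<otimes> x \<otimes> inv v \<in> par J" if x: "x \<in> par K" for x
  proof -
    have "x \<in> carrier G" using x K parabolic_carrier by simp
    then have "v \<otimes> x \<otimes> inv v = w \<otimes> (z \<otimes> x \<otimes> inv z) \<otimes> inv w"
      using z by (simp add: vz m_assoc inv_mult_group)
    moreover have "z \<otimes> x \<otimes> inv z \<in> par K"
      using parabolic_mult[OF K parabolic_mult[OF K z(1) x] parabolic_inv[OF K z(1)]] .
    ultimately show ?thesis using block_conj(1)[OF b] by simp
  qed
  moreover have "inv v \<otimes> y \<otimes> v \<in> par K" if y: "y \<in> par J" for y
  proof -
    have "y \<in> carrier G" using y J parabolic_carrier by simp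
    then have "inv v \<otimes> y \<otimes> v = inv z \<otimes> (inv w \<otimes> y \<otimes> w) \<otimes> z"
      using z by (simp add: vz m_assoc inv_mult_group)
    then show ?thesis
      using parabolic_mult[OF K parabolic_mult[OF K parabolic_inv[OF K z(1)] block_conj(2)[OF b y]] z(1)]
      by simp
  qed
  ultimately show ?thesis using block_iff_conj[OF v(1) J K] by simp
qed

lemma block_coset_min: "block w J K \<Longrightarrow> block (cm w K) J K"
  using block_translate coset_min_closed coset_min_in_coset blockD by metis

text \<open>
  The coset \<open>w W\<^sub>K = W\<^sub>J w\<close> has a single shortest element, which is minimal on both sides. So \<open>w\<^sup>K\<close>
  has no inversions in \<open>W\<^sub>J\<close>, while its inversions differ from those of \<open>w\<close> only by conjugates of
  elements of \<open>W\<^sub>K\<close> under \<open>w\<^sup>K\<close>, which are in \<open>W\<^sub>J\<close>.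
\<close>

lemma block_coset_min_inv:
  assumes b: "block w J K"
  shows "cm (inv w) J = inv (cm w K)" "inversions (cm w K) = inversions w - par J"
proof -
  note w = blockD(1)[OF b] and J = blockD(2)[OF b] and K = blockD(3)[OF b]
  define v where "v = cm w K"
  have v: "v \<in> carrier G" "inv w \<otimes> v \<in> par K" "inversions (inv v) \<inter> par K = {}"
    using coset_min_mem[OF w K] by (simp_all add: v_def)
  have bv: "block v J K" using block_coset_min[OF b] by (simp add: v_def)
  have disj: "inversions v \<inter> par J = {}"
  proof (rule ccontr)
    assume "inversions v \<inter> par J \<noteq> {}"
    then obtain t where t: "t \<in> inversions v" "t \<in> par J" by blast
    have tc: "t \<in> carrier G" using t J parabolic_carrier by simp
    have z: "inv (inv v \<otimes> t \<otimes> v) \<in> par K" using parabolic_inv[OF K block_conj(2)[OF bv t(2)]] .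
    have "len (inv (inv v \<otimes> t \<otimes> v) \<otimes> inv v) = len (inv (inv v \<otimes> t \<otimes> v)) + len (inv v)"
      using len_mult_disjoint[OF _ z K v(3)] v by simp
    moreover have "inv (inv v \<otimes> t \<otimes> v) \<otimes> inv v = inv (t \<otimes> v)"
      using v tc by (simp add: m_assoc inv_mult_group)
    ultimately have "len v \<le> len (t \<otimes> v)" using v tc by (simp add: len_inv)
    then show False using inversion_shortens[OF v(1) t(1)] by simp
  qed
  have "inv (inv w \<otimes> v) \<in> par K" using parabolic_inv[OF K v(2)] .
  then have z: "inv v \<otimes> w \<in> par K" using w v by (simp add: inv_mult_group)
  have diff: "t \<in> par J" if t: "(t \<in> inversions v) \<noteq> (t \<in> inversions w)" for t
  proof -
    have tc: "t \<in> carrier G" using t inversions_closed[OF w] inversions_closed[OF v(1)] by auto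
    then have e: "v \<otimes> (inv v \<otimes> t \<otimes> v) \<otimes> inv v = t" using v by (simp add: m_assoc)
    have "inv v \<otimes> t \<otimes> v \<in> inversions (inv v \<otimes> w)"
      using inversions_quotient[OF v(1) w, of "inv v \<otimes> t \<otimes> v"] t tc v e by simp
    then have "inv v \<otimes> t \<otimes> v \<in> par K" using inversions_in_parabolic[OF K z] by auto
    then have "v \<otimes> (inv v \<otimes> t \<otimes> v) \<otimes> inv v \<in> par J" using block_conj(1)[OF bv] by simp
    then show ?thesis by (simp add: e)
  qed
  show "inversions (cm w K) = inversions w - par J"
    using diff disj unfolding v_def[symmetric] by blast
  show "cm (inv w) J = inv (cm w K)" unfolding v_def[symmetric]
  proof (rule coset_min_eqI)
    have "w \<otimes> (inv w \<otimes> v) \<otimes> inv w \<in> par J" using block_conj(1)[OF b v(2)] .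
    then have "v \<otimes> inv w \<in> par J" using w v by simp
    then have "inv (v \<otimes> inv w) \<in> par J" using parabolic_inv[OF J] by simp
    then show "inv (inv w) \<otimes> inv v \<in> par J" using w v by (simp add: inv_mult_group)
  qed (use w v J disj in auto)
qed

lemmas coset_min_inv = block_coset_min_inv(1)
lemmas inversions_coset_min = block_coset_min_inv(2)

lemma inversions_inv_coset_min:
  assumes b: "block w J K" shows "inversions (inv (cm w K)) = inversions (inv w) - par K"
  using inversions_coset_min[OF block_inv[OF b]] coset_min_inv[OF b] by simp

lemma block_UN:
  assumes w: "w \<in> carrier G" and b: "\<And>a. a \<in> A \<Longrightarrow> block w (J a) (K a)"
  shows "block w (\<Union>a\<in>A. J a) (\<Union>a\<in>A. K a)"
proof -
  have half: "w \<otimes> x \<otimes> inv w \<in> par (\<Union>a\<in>A. J a)"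
    if w: "w \<in> carrier G" and b: "\<And>a. a \<in> A \<Longrightarrow> block w (J a) (K a)"
      and x: "x \<in> par (\<Union>a\<in>A. K a)" for w J K x
  proof -
    have JI: "(\<Union>a\<in>A. J a) \<subseteq> I" and KI: "(\<Union>a\<in>A. K a) \<subseteq> I"
      using b blockD(2,3) by blast+
    obtain xs where xs: "xs \<in> lists (\<Union>a\<in>A. K a)" "x = wp xs"
      using x parabolic_eq_words[OF KI] by auto
    have "w \<otimes> wp xs \<otimes> inv w \<in> par (\<Union>a\<in>A. J a)" using xs(1)
    proof induction
      case Nil
      then show ?case using w by (simp add: parabolic_one)
    next
      case (Cons k ks)
      then obtain a where a: "a \<in> A" "k \<in> K a" by auto
      have k: "s k \<in> carrier G" using a(2) blockD(3)[OF b[OF a(1)]] by auto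
      have "ks \<in> lists I" using Cons.hyps KI by auto
      then have ks: "wp ks \<in> carrier G" by simp
      have "w \<otimes> s k \<otimes> inv w \<in> par (J a)"
        using block_conj(1)[OF b[OF a(1)]] parabolic_simple[OF a(2)] by simp
      then have "w \<otimes> s k \<otimes> inv w \<in> par (\<Union>a\<in>A. J a)"
        using parabolic_mono[of "J a" "\<Union>a\<in>A. J a"] a(1) by blast
      from parabolic_mult[OF JI this Cons.IH]
      show ?case using w k ks by (simp add: m_assoc)
    qed
    then show ?thesis using xs by simp
  qed
  have "(\<Union>a\<in>A. J a) \<subseteq> I" "(\<Union>a\<in>A. K a) \<subseteq> I" using b blockD(2,3) by blast+
  moreover have "inv w \<otimes> y \<otimes> w \<in> par (\<Union>a\<in>A. K a)" if "y \<in> par (\<Union>a\<in>A. J a)" for y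
    using half[of "inv w" K J y] block_inv[OF b] w that by simp
  ultimately show ?thesis using block_iff_conj w half[OF w b] by simp
qed

lemma block_Un:
  assumes "block w J K" "block w J' K'" shows "block w (J \<union> J') (K \<union> K')"
proof -
  have "block w (fst a) (snd a)" if "a \<in> {(J, K), (J', K')}" for a
    using that assms by auto
  from block_UN[OF blockD(1)[OF assms(1)], of "{(J, K), (J', K')}" fst snd, OF this] show ?thesis by simp
qed

lemma block_Int:
  assumes "block w J K" "block w J' K'" shows "block w (J \<inter> J') (K \<inter> K')"
proof -
  note I = blockD[OF assms(1)] blockD[OF assms(2)]
  have "J \<inter> J' \<subseteq> I" "K \<inter> K' \<subseteq> I" using I by auto
  moreover have "w \<otimes> x \<otimes> inv w \<in> par (J \<inter> J')" if "x \<in> par (K \<inter> K')" for x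
    using that block_conj(1)[OF assms(1), of x] block_conj(1)[OF assms(2), of x] I
    by (simp flip: parabolic_Int)
  moreover have "inv w \<otimes> y \<otimes> w \<in> par (K \<inter> K')" if "y \<in> par (J \<inter> J')" for y
    using that block_conj(2)[OF assms(1), of y] block_conj(2)[OF assms(2), of y] I
    by (simp flip: parabolic_Int)
  ultimately show ?thesis using block_iff_conj[OF I(1)] by simp
qed

text \<open>
  Being below a cutting point of \<open>w\<close> in right order means being below \<open>w\<close> and having no inversion in
  \<open>W\<^sub>J\<close>. By \<open>inversions_disjoint_UN\<close> these conditions add up to the one for the union of the blocks,
  which is the meet formula.
\<close>

lemma inversions_le_coset_min_UN:
  assumes w: "w \<in> carrier G" and x: "x \<in> carrier G"
    and b: "\<And>a. a \<in> A \<Longrightarrow> block w (J a) (K a)"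
  shows "inversions x \<subseteq> inversions (cm w (\<Union>a\<in>A. K a)) \<longleftrightarrow>
    inversions x \<subseteq> inversions w \<and> (\<forall>a\<in>A. inversions x \<subseteq> inversions (cm w (K a)))"
proof -
  have "inversions x \<subseteq> inversions (cm w (\<Union>a\<in>A. K a)) \<longleftrightarrow>
      inversions x \<subseteq> inversions w \<and> inversions x \<inter> par (\<Union>a\<in>A. J a) = {}"
    using inversions_coset_min[OF block_UN[OF w, of A J K, OF b]] by auto
  also have "\<dots> \<longleftrightarrow> inversions x \<subseteq> inversions w \<and> (\<forall>a\<in>A. inversions x \<inter> par (J a) = {})"
    using inversions_disjoint_UN[OF x, of A J] blockD(2)[OF b] by simp
  also have "\<dots> \<longleftrightarrow> inversions x \<subseteq> inversions w \<and> (\<forall>a\<in>A. inversions x \<subseteq> inversions (cm w (K a)))"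
  proof -
    have "inversions x \<inter> par (J a) = {} \<longleftrightarrow> inversions x \<subseteq> inversions (cm w (K a))"
      if "a \<in> A" "inversions x \<subseteq> inversions w" for a
      using inversions_coset_min[OF b[OF that(1)]] that(2) by auto
    then show ?thesis by auto
  qed
  finally show ?thesis .
qed

lemma inversions_le_coset_min_Un:
  assumes x: "x \<in> carrier G" and b: "block w J K" "block w J' K'"
  shows "inversions x \<subseteq> inversions (cm w (K \<union> K')) \<longleftrightarrow>
    inversions x \<subseteq> inversions (cm w K) \<and> inversions x \<subseteq> inversions (cm w K')"
proof -
  have "block w (fst a) (snd a)" if "a \<in> {(J, K), (J', K')}" for a
    using that b by auto
  from inversions_le_coset_min_UN[OF blockD(1)[OF b(1)] x, of "{(J, K), (J', K')}" fst snd, OF this]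
  have "inversions x \<subseteq> inversions (cm w (K \<union> K')) \<longleftrightarrow>
    inversions x \<subseteq> inversions w \<and> inversions x \<subseteq> inversions (cm w K) \<and> inversions x \<subseteq> inversions (cm w K')"
    by simp
  then show ?thesis using inversions_coset_min[OF b(1)] by auto
qed

text \<open>
  The join formula.
\<close>

lemma inversions_coset_min_Int:
  assumes b: "block w J K" "block w J' K'"
  shows "inversions (cm w (K \<inter> K')) = inversions (cm w K) \<union> inversions (cm w K')"
  using inversions_coset_min[OF block_Int[OF b]] inversions_coset_min[OF b(1)]
    inversions_coset_min[OF b(2)] parabolic_Int[OF blockD(2)[OF b(1)] blockD(2)[OF b(2)]]
  by auto

definition cutting_point :: "'a \<Rightarrow> 'a \<Rightarrow> bool" where
  "cutting_point v w \<longleftrightarrow> (\<exists>J K. block w J K \<and> v = cm w K)"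

lemma cut_closed: "cutting_point v w \<Longrightarrow> v \<in> carrier G \<and> w \<in> carrier G"
  using coset_min_closed blockD unfolding cutting_point_def by metis

lemma block_empty: "w \<in> carrier G \<Longrightarrow> block w {} {}"
  using block_UN[of w "{}"] by simp

lemma coset_min_empty:
  assumes "w \<in> carrier G" shows "cm w {} = w"
proof -
  have "par {} = {\<one>}" using parabolic_eq_words[of "{}"] by simp
  moreover have "\<one> \<notin> inversions (inv w)"
  proof
    assume "\<one> \<in> inversions (inv w)"
    then show False using inversion_shortens[of "inv w" \<one>] assms by simp
  qed
  ultimately show ?thesis using coset_min_eqI[of w "{}" w] assms by simp
qed

lemma cut_refl: "w \<in> carrier G \<Longrightarrow> cutting_point w w"
  using block_empty coset_min_empty unfolding cutting_point_def by metis

lemma cut_right: "cutting_point v w \<Longrightarrow> inversions v \<subseteq> inversions w"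
  using inversions_coset_min unfolding cutting_point_def by blast

lemma cut_left: "cutting_point v w \<Longrightarrow> inversions (inv v) \<subseteq> inversions (inv w)"
  using inversions_inv_coset_min unfolding cutting_point_def by blast

lemma cut_inv: "cutting_point v w \<Longrightarrow> cutting_point (inv v) (inv w)"
  using block_inv coset_min_inv unfolding cutting_point_def by metis

text \<open>
  Larger blocks give smaller cutting points: the coset of the larger block contains \<open>w\<^sup>K\<close>.
\<close>

lemma cut_coset_min_mono:
  assumes "block w J K" "block w J' K'" "K \<subseteq> K'"
  shows "cutting_point (cm w K') (cm w K)"
proof -
  note w = blockD(1)[OF assms(1)] and K = blockD(3)[OF assms(1)] and K' = blockD(3)[OF assms(2)]
  have "inv w \<otimes> cm w K \<in> par K'"
    using coset_min_in_coset[OF w K] parabolic_mono[OF assms(3)] by blast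
  then have "block (cm w K) J' K'" "cm (cm w K) K' = cm w K'"
    using block_translate[OF assms(2)] coset_min_cong[OF w] coset_min_closed[OF w K] K' by auto
  then show ?thesis unfolding cutting_point_def by metis
qed

text \<open>
  Cutting at \<open>K\<close> and then at \<open>K'\<close> is cutting at \<open>K \<union> K'\<close>. Both sides have the same inversions: those
  of the left side avoid \<open>W\<^sub>J\<close> and \<open>W\<^bsub>J'\<^esub>\<close>, hence \<open>W\<^bsub>J \<union> J'\<^esub>\<close>.
\<close>

lemma cut_trans_block:
  assumes b: "block w J K" and b': "block (cm w K) J' K'"
  shows "block w (J \<union> J') (K \<union> K')" "cm (cm w K) K' = cm w (K \<union> K')"
proof -
  note w = blockD(1)[OF b] and K = blockD(3)[OF b] and K' = blockD(3)[OF b']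
  define v where "v = cm w K"
  have v: "v \<in> carrier G" "inv w \<otimes> v \<in> par K" using coset_min_mem[OF w K] by (simp_all add: v_def)
  have "inv (inv w \<otimes> v) \<in> par (K \<union> K')"
    using parabolic_inv[OF K v(2)] parabolic_mono[of K "K \<union> K'"] by blast
  then have "inv v \<otimes> w \<in> par (K \<union> K')" using v w by (simp add: inv_mult_group)
  moreover have "block v (J \<union> J') (K \<union> K')"
    using block_Un[OF block_coset_min[OF b] b'] by (simp add: v_def)
  ultimately show bw: "block w (J \<union> J') (K \<union> K')" using block_translate w by simp
  define u where "u = cm v K'"
  have u: "u \<in> carrier G" using coset_min_closed[OF v(1) K'] by (simp add: u_def)
  have iu: "inversions u = inversions w - par J - par J'"
    using inversions_coset_min[OF b'] inversions_coset_min[OF b] by (simp add: u_def v_def)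
  have "inversions u \<inter> par (J \<union> J') = {}"
    using inversions_disjoint_UN[OF u, of "{J, J'}" "\<lambda>J. J"] iu blockD(2)[OF b] blockD(2)[OF b']
    by fastforce
  moreover have "par J \<union> par J' \<subseteq> par (J \<union> J')" using parabolic_mono by simp
  ultimately have "inversions u = inversions (cm w (K \<union> K'))"
    using inversions_coset_min[OF bw] iu by blast
  then show "cm (cm w K) K' = cm w (K \<union> K')"
    using inversions_inject[OF u coset_min_closed[OF w]] blockD(3)[OF bw] by (simp add: u_def v_def)
qed

lemma cut_trans: "cutting_point u v \<Longrightarrow> cutting_point v w \<Longrightarrow> cutting_point u w"
  using cut_trans_block unfolding cutting_point_def by metis

lemma cut_antisym: "cutting_point u v \<Longrightarrow> cutting_point v u \<Longrightarrow> u = v"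
  by (intro inversions_inject equalityI cut_right) (use cut_closed in blast)+

lemma one_cut:
  assumes "w \<in> carrier G" shows "cutting_point \<one> w"
proof -
  have I: "par I = carrier G" by (simp add: parabolic_def simple_generate)
  have "block w I I" using assms block_iff_conj[of w I I] I by simp
  moreover have "cm w I = \<one>" using coset_min_eqI[of w I \<one>] assms I by simp
  ultimately show ?thesis unfolding cutting_point_def by metis
qed

text \<open>
  Below a common bound \<open>w\<close> the cutting order is induced by right order: if \<open>w\<^sup>K \<le>\<^sub>R w\<^bsup>K'\<^esup>\<close>, the meet
  \<open>w\<^bsup>K \<union> K'\<^esup>\<close> of the two is \<open>w\<^sup>K\<close>, and it is a cutting point of \<open>w\<^bsup>K'\<^esup>\<close>.
\<close>

lemma cut_iff_right:
  assumes "cutting_point u w" "cutting_point v w"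
  shows "cutting_point u v \<longleftrightarrow> inversions u \<subseteq> inversions v"
proof
  assume le: "inversions u \<subseteq> inversions v"
  obtain J K J' K' where b: "block w J K" "u = cm w K" "block w J' K'" "v = cm w K'"
    using assms unfolding cutting_point_def by blast
  note w = blockD(1)[OF b(1)]
  have bU: "block w (J \<union> J') (K \<union> K')" using block_Un b by simp
  have c: "u \<in> carrier G" "cm w (K \<union> K') \<in> carrier G"
    using coset_min_closed[OF w] blockD(3)[OF b(1)] blockD(3)[OF bU] b(2) by simp_all
  have "inversions u \<subseteq> inversions (cm w (K \<union> K'))"
    using inversions_le_coset_min_Un[OF c(1) b(1) b(3)] le b(2,4) by simp
  moreover have "inversions (cm w (K \<union> K')) \<subseteq> inversions u"
    using inversions_le_coset_min_Un[OF c(2) b(1) b(3)] b(2) by simp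
  ultimately have "u = cm w (K \<union> K')" using inversions_inject c by simp
  then show "cutting_point u v" using cut_coset_min_mono[OF b(3) bU] b(4) by simp
qed (rule cut_right)

lemma cut_iff_left:
  assumes "cutting_point u w" "cutting_point v w"
  shows "cutting_point u v \<longleftrightarrow> inversions (inv u) \<subseteq> inversions (inv v)"
proof -
  have "cutting_point u v \<longleftrightarrow> cutting_point (inv u) (inv v)"
    using cut_inv[of u v] cut_inv[of "inv u" "inv v"] cut_closed assms by auto
  then show ?thesis using cut_iff_right[OF cut_inv[OF assms(1)] cut_inv[OF assms(2)]] by simp
qed

lemma coset_min_Un_cut:
  assumes "block w J K" "block w J' K'" "cutting_point u (cm w K)" "cutting_point u (cm w K')"
  shows "cutting_point u (cm w (K \<union> K'))"
proof -
  have u: "u \<in> carrier G" using cut_closed assms by blast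
  have bU: "block w (J \<union> J') (K \<union> K')" using block_Un assms by simp
  have "cutting_point (cm w K) w" "cutting_point (cm w (K \<union> K')) w" using assms bU unfolding cutting_point_def by blast+
  moreover have "cutting_point u w" using cut_trans[OF assms(3)] calculation by simp
  moreover have "inversions u \<subseteq> inversions (cm w (K \<union> K'))"
    using inversions_le_coset_min_Un[OF u assms(1,2)] cut_right assms(3,4) by simp
  ultimately show ?thesis using cut_iff_right[of u w "cm w (K \<union> K')"] by simp
qed

end

section \<open>Finite posets\<close>

lemma is_glbI:
  assumes "m \<in> carrier L" "\<And>x. x \<in> A \<Longrightarrow> x \<in> carrier L \<Longrightarrow> m \<sqsubseteq>\<^bsub>L\<^esub> x"
    and "\<And>z. z \<in> carrier L \<Longrightarrow> (\<And>x. x \<in> A \<Longrightarrow> x \<in> carrier L \<Longrightarrow> z \<sqsubseteq>\<^bsub>L\<^esub> x) \<Longrightarrow> z \<sqsubseteq>\<^bsub>L\<^esub> m"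
  shows "is_glb L m A"
  using assms unfolding greatest_def Lower_def by auto

lemma is_lubI:
  assumes "m \<in> carrier L" "\<And>x. x \<in> A \<Longrightarrow> x \<in> carrier L \<Longrightarrow> x \<sqsubseteq>\<^bsub>L\<^esub> m"
    and "\<And>z. z \<in> carrier L \<Longrightarrow> (\<And>x. x \<in> A \<Longrightarrow> x \<in> carrier L \<Longrightarrow> x \<sqsubseteq>\<^bsub>L\<^esub> z) \<Longrightarrow> m \<sqsubseteq>\<^bsub>L\<^esub> z"
  shows "is_lub L m A"
  using assms unfolding least_def Upper_def by auto

lemma (in partial_order) inf_eqI: "is_glb L m A \<Longrightarrow> \<Sqinter>A = m"
  unfolding inf_def by (rule some_equality) (auto dest: greatest_unique)

lemma (in partial_order) sup_eqI: "is_lub L m A \<Longrightarrow> \<Squnion>A = m"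
  unfolding sup_def by (rule some_equality) (auto dest: least_unique)

lemma partial_order_interval:
  assumes "partial_order L" shows "partial_order (interval_order L u w)"
proof -
  interpret partial_order L by fact
  show ?thesis
    by unfold_locales (auto simp: interval_order_def at_least_at_most_def eq_is_equal intro: le_trans le_antisym)
qed

lemma sublattice_ofI:
  assumes P: "partial_order P" and sub: "carrier P \<subseteq> carrier L"
    and le: "\<And>x y. x \<in> carrier P \<Longrightarrow> y \<in> carrier P \<Longrightarrow> x \<sqsubseteq>\<^bsub>P\<^esub> y \<longleftrightarrow> x \<sqsubseteq>\<^bsub>L\<^esub> y"
    and glb: "\<And>x y. x \<in> carrier P \<Longrightarrow> y \<in> carrier P \<Longrightarrow> \<exists>m \<in> carrier P. is_glb L m {x, y}"
    and lub: "\<And>x y. x \<in> carrier P \<Longrightarrow> y \<in> carrier P \<Longrightarrow> \<exists>m \<in> carrier P. is_lub L m {x, y}"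
  shows "sublattice_of P L"
proof -
  interpret P: partial_order P by (rule P)
  have glbP: "is_glb P m {x, y}"
    if xy: "x \<in> carrier P" "y \<in> carrier P" and "m \<in> carrier P" "is_glb L m {x, y}" for x y m
  proof (rule is_glbI)
    have m: "m \<sqsubseteq>\<^bsub>L\<^esub> x" "m \<sqsubseteq>\<^bsub>L\<^esub> y"
      and great: "\<And>z. z \<in> carrier L \<Longrightarrow> z \<sqsubseteq>\<^bsub>L\<^esub> x \<Longrightarrow> z \<sqsubseteq>\<^bsub>L\<^esub> y \<Longrightarrow> z \<sqsubseteq>\<^bsub>L\<^esub> m"
      using that sub by (auto simp: greatest_def Lower_def)
    show "m \<sqsubseteq>\<^bsub>P\<^esub> t" if "t \<in> {x, y}" for t using m le that \<open>m \<in> carrier P\<close> xy by auto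
    show "z \<sqsubseteq>\<^bsub>P\<^esub> m" if "z \<in> carrier P" "\<And>t. t \<in> {x, y} \<Longrightarrow> t \<in> carrier P \<Longrightarrow> z \<sqsubseteq>\<^bsub>P\<^esub> t" for z
      using that great[of z] le xy sub \<open>m \<in> carrier P\<close> by auto
  qed (rule \<open>m \<in> carrier P\<close>)
  have lubP: "is_lub P m {x, y}"
    if xy: "x \<in> carrier P" "y \<in> carrier P" and "m \<in> carrier P" "is_lub L m {x, y}" for x y m
  proof (rule is_lubI)
    have m: "x \<sqsubseteq>\<^bsub>L\<^esub> m" "y \<sqsubseteq>\<^bsub>L\<^esub> m"
      and least: "\<And>z. z \<in> carrier L \<Longrightarrow> x \<sqsubseteq>\<^bsub>L\<^esub> z \<Longrightarrow> y \<sqsubseteq>\<^bsub>L\<^esub> z \<Longrightarrow> m \<sqsubseteq>\<^bsub>L\<^esub> z"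
      using that sub by (auto simp: least_def Upper_def)
    show "t \<sqsubseteq>\<^bsub>P\<^esub> m" if "t \<in> {x, y}" for t using m le that \<open>m \<in> carrier P\<close> xy by auto
    show "m \<sqsubseteq>\<^bsub>P\<^esub> z" if "z \<in> carrier P" "\<And>t. t \<in> {x, y} \<Longrightarrow> t \<in> carrier P \<Longrightarrow> t \<sqsubseteq>\<^bsub>P\<^esub> z" for z
      using that least[of z] le xy sub \<open>m \<in> carrier P\<close> by auto
  qed (rule \<open>m \<in> carrier P\<close>)
  have "\<exists>m. is_glb P m {x, y}" if xy: "x \<in> carrier P" "y \<in> carrier P" for x y
    using glb[OF xy] glbP[OF xy] by metis
  moreover have "\<exists>m. is_lub P m {x, y}" if xy: "x \<in> carrier P" "y \<in> carrier P" for x y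
    using lub[OF xy] lubP[OF xy] by metis
  ultimately have "lattice P" by unfold_locales
  moreover have "is_glb L (x \<sqinter>\<^bsub>P\<^esub> y) {x, y}" if xy: "x \<in> carrier P" "y \<in> carrier P" for x y
  proof -
    obtain m where m: "m \<in> carrier P" "is_glb L m {x, y}" using glb[OF xy] by blast
    then have "x \<sqinter>\<^bsub>P\<^esub> y = m" using P.inf_eqI[OF glbP[OF xy m]] by (simp add: meet_def)
    then show ?thesis using m by simp
  qed
  moreover have "is_lub L (x \<squnion>\<^bsub>P\<^esub> y) {x, y}" if xy: "x \<in> carrier P" "y \<in> carrier P" for x y
  proof -
    obtain m where m: "m \<in> carrier P" "is_lub L m {x, y}" using lub[OF xy] by blast
    then have "x \<squnion>\<^bsub>P\<^esub> y = m" using P.sup_eqI[OF lubP[OF xy m]] by (simp add: join_def)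
    then show ?thesis using m by simp
  qed
  ultimately show ?thesis unfolding sublattice_of_def using sub le by blast
qed

lemma sum_moebius:
  assumes L: "partial_order L" "finite (carrier L)" and u: "u \<in> carrier L" and w: "w \<in> carrier L"
    and uw: "u \<sqsubseteq>\<^bsub>L\<^esub> w"
  shows "(\<Sum>v \<in> {v \<in> carrier L. u \<sqsubseteq>\<^bsub>L\<^esub> v \<and> v \<sqsubseteq>\<^bsub>L\<^esub> w}. moebius L u v) = (if u = w then 1 else 0)"
proof -
  interpret partial_order L by (rule L)
  let ?S = "{v \<in> carrier L. u \<sqsubseteq>\<^bsub>L\<^esub> v \<and> v \<sqsubset>\<^bsub>L\<^esub> w}"
  have "{v \<in> carrier L. u \<sqsubseteq>\<^bsub>L\<^esub> v \<and> v \<sqsubseteq>\<^bsub>L\<^esub> w} = insert w ?S"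
    using u w uw by (auto simp: lless_eq)
  moreover have "w \<notin> ?S" "finite ?S" using L by (auto simp: lless_eq)
  ultimately have sum: "(\<Sum>v \<in> {v \<in> carrier L. u \<sqsubseteq>\<^bsub>L\<^esub> v \<and> v \<sqsubseteq>\<^bsub>L\<^esub> w}. moebius L u v) =
      moebius L u w + (\<Sum>v\<in>?S. moebius L u v)" by simp
  show ?thesis
  proof (cases "u = w")
    case True
    then have "?S = {}" using u by (auto simp: lless_eq)
    then have "(\<Sum>v\<in>?S. moebius L u v) = 0" by (simp only: sum.empty)
    then show ?thesis using sum True assms by (simp add: moebius.simps[of L w w])
  next
    case False
    then have "moebius L u w = - (\<Sum>v\<in>?S. moebius L u v)"
      using assms by (simp add: moebius.simps[of L u w])
    then show ?thesis using sum False by simp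
  qed
qed

text \<open>
  In the incidence algebra: the recursion says that \<open>\<mu>\<close> is a left inverse of the zeta function, the
  hypothesis that \<open>f\<close> behaves in column \<open>w\<close> like a right inverse, and the two inverses agree.
\<close>

lemma moebius_unique:
  assumes L: "partial_order L" "finite (carrier L)" and w: "w \<in> carrier L"
    and f: "\<And>v. v \<in> carrier L \<Longrightarrow> v \<sqsubseteq>\<^bsub>L\<^esub> w \<Longrightarrow>
      (\<Sum>x \<in> {x \<in> carrier L. v \<sqsubseteq>\<^bsub>L\<^esub> x \<and> x \<sqsubseteq>\<^bsub>L\<^esub> w}. f x) = (if v = w then 1 else 0)"
    and u: "u \<in> carrier L" "u \<sqsubseteq>\<^bsub>L\<^esub> w"
  shows "moebius L u w = f u"
proof -
  interpret partial_order L by (rule L)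
  let ?S = "{v \<in> carrier L. u \<sqsubseteq>\<^bsub>L\<^esub> v \<and> v \<sqsubseteq>\<^bsub>L\<^esub> w}"
  have fin: "finite ?S" using L by simp
  have "moebius L u w = (\<Sum>v\<in>?S. moebius L u v * (if v = w then 1 else 0))"
    using fin w u by (subst sum.remove[of _ w]) (auto intro!: sum.neutral)
  also have "\<dots> = (\<Sum>v\<in>?S. \<Sum>x | x \<in> ?S \<and> v \<sqsubseteq>\<^bsub>L\<^esub> x. moebius L u v * f x)"
  proof (rule sum.cong[OF HOL.refl])
    fix v assume v: "v \<in> ?S"
    then have "{x \<in> ?S. v \<sqsubseteq>\<^bsub>L\<^esub> x} = {x \<in> carrier L. v \<sqsubseteq>\<^bsub>L\<^esub> x \<and> x \<sqsubseteq>\<^bsub>L\<^esub> w}"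
      using u le_trans by blast
    then show "moebius L u v * (if v = w then 1 else 0) = (\<Sum>x | x \<in> ?S \<and> v \<sqsubseteq>\<^bsub>L\<^esub> x. moebius L u v * f x)"
      using f[of v] v by (simp flip: sum_distrib_left)
  qed
  also have "\<dots> = (\<Sum>x\<in>?S. \<Sum>v | v \<in> ?S \<and> v \<sqsubseteq>\<^bsub>L\<^esub> x. moebius L u v * f x)"
    using fin by (rule sum.swap_restrict) (rule fin)
  also have "\<dots> = (\<Sum>x\<in>?S. (if u = x then 1 else 0) * f x)"
  proof (rule sum.cong[OF HOL.refl])
    fix x assume x: "x \<in> ?S"
    then have "{v \<in> ?S. v \<sqsubseteq>\<^bsub>L\<^esub> x} = {v \<in> carrier L. u \<sqsubseteq>\<^bsub>L\<^esub> v \<and> v \<sqsubseteq>\<^bsub>L\<^esub> x}"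
      using w le_trans by blast
    then show "(\<Sum>v | v \<in> ?S \<and> v \<sqsubseteq>\<^bsub>L\<^esub> x. moebius L u v * f x) = (if u = x then 1 else 0) * f x"
      using sum_moebius[OF L u(1), of x] x by (simp flip: sum_distrib_right)
  qed
  also have "\<dots> = f u"
    using fin u by (subst sum.remove[of _ u]) (auto intro!: sum.neutral split: if_splits)
  finally show ?thesis .
qed

text \<open>
  This is the expansion of a product of factors \<open>1 - 1\<close>.
\<close>

lemma sum_alternating_Pow:
  assumes "finite A" shows "(\<Sum>B\<in>Pow A. (-1) ^ card B :: int) = (if A = {} then 1 else 0)"
  using prod_diff_conv_sum[OF assms, of "\<lambda>_. 1 :: int" "\<lambda>_. 1"] assms
  by (simp add: power_0_left)

lemma ex_lower_cover:
  assumes L: "partial_order L" "finite (carrier L)" and u: "u \<in> carrier L" and w: "w \<in> carrier L"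
    and uw: "u \<sqsubseteq>\<^bsub>L\<^esub> w" "u \<noteq> w"
  obtains c where "c \<in> lower_covers L w" "u \<sqsubseteq>\<^bsub>L\<^esub> c"
proof -
  interpret partial_order L by (rule L)
  let ?P = "\<lambda>x. x \<in> carrier L \<and> u \<sqsubseteq>\<^bsub>L\<^esub> x \<and> x \<sqsubset>\<^bsub>L\<^esub> w"
  let ?h = "\<lambda>x. card {y \<in> carrier L. y \<sqsubseteq>\<^bsub>L\<^esub> x}"
  have "?P u" using u uw by (simp add: lless_eq)
  moreover have "\<forall>y. ?P y \<longrightarrow> ?h y < Suc (card (carrier L))"
    using L by (auto simp: less_Suc_eq_le intro: card_mono)
  ultimately have "\<exists>c. ?P c \<and> (\<forall>y. ?P y \<longrightarrow> ?h y \<le> ?h c)"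
    using ex_has_greatest_nat[of ?P u ?h "Suc (card (carrier L))"] by simp
  \<comment> \<open>An element below which there are as many elements as possible is maximal.\<close>
  then obtain c where c: "?P c" and "\<forall>y. ?P y \<longrightarrow> ?h y \<le> ?h c" by (elim exE) (erule conjE)
  then have max: "?h y \<le> ?h c" if "?P y" for y using that by simp
  have "\<not> (c \<sqsubset>\<^bsub>L\<^esub> x \<and> x \<sqsubset>\<^bsub>L\<^esub> w)" if x: "x \<in> carrier L" for x
  proof
    assume *: "c \<sqsubset>\<^bsub>L\<^esub> x \<and> x \<sqsubset>\<^bsub>L\<^esub> w"
    have cx: "c \<sqsubseteq>\<^bsub>L\<^esub> x" "c \<noteq> x" using * by (auto simp: lless_eq)
    then have "{y \<in> carrier L. y \<sqsubseteq>\<^bsub>L\<^esub> c} \<subseteq> {y \<in> carrier L. y \<sqsubseteq>\<^bsub>L\<^esub> x}"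
      using c x le_trans by blast
    moreover have "x \<notin> {y \<in> carrier L. y \<sqsubseteq>\<^bsub>L\<^esub> c}" "x \<in> {y \<in> carrier L. y \<sqsubseteq>\<^bsub>L\<^esub> x}"
      using c x cx le_antisym by auto
    ultimately have "{y \<in> carrier L. y \<sqsubseteq>\<^bsub>L\<^esub> c} \<subset> {y \<in> carrier L. y \<sqsubseteq>\<^bsub>L\<^esub> x}" by blast
    then have "?h c < ?h x" using L(2) by (intro psubset_card_mono) auto
    moreover have "u \<sqsubseteq>\<^bsub>L\<^esub> x" using le_trans c cx x u by blast
    then have "?h x \<le> ?h c" using max[of x] * x by blast
    ultimately show False by simp
  qed
  then have "c \<in> lower_covers L w" using c unfolding lower_covers_def by blast
  then show ?thesis using that c by blast
qed

text \<open>
  Put \<open>f x = (-1)\<^sup>r\<close> if \<open>x\<close> is the meet of \<open>r\<close> lower covers of \<open>w\<close>, and 0 otherwise. The sum of \<open>f\<close>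
  over the interval from \<open>v\<close> to \<open>w\<close> runs over all sets of lower covers above \<open>v\<close>, and vanishes as soon as
  there is such a cover, that is for \<open>v \<noteq> w\<close>. So \<open>f\<close> is the Moebius function.
\<close>

lemma moebius_cover_meets:
  assumes L: "partial_order L" "finite (carrier L)" and w: "w \<in> carrier L"
    and m: "\<And>A. A \<subseteq> lower_covers L w \<Longrightarrow> m A \<in> carrier L \<and> m A \<sqsubseteq>\<^bsub>L\<^esub> w"
    and glb: "\<And>A v. A \<subseteq> lower_covers L w \<Longrightarrow> v \<in> carrier L \<Longrightarrow> v \<sqsubseteq>\<^bsub>L\<^esub> w \<Longrightarrow>
      v \<sqsubseteq>\<^bsub>L\<^esub> m A \<longleftrightarrow> (\<forall>c\<in>A. v \<sqsubseteq>\<^bsub>L\<^esub> c)"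
    and inj: "inj_on m (Pow (lower_covers L w))"
    and u: "u \<in> carrier L" "u \<sqsubseteq>\<^bsub>L\<^esub> w"
  shows "A \<subseteq> lower_covers L w \<Longrightarrow> u = m A \<Longrightarrow> moebius L u w = (-1) ^ card A"
    and "u \<notin> m ` Pow (lower_covers L w) \<Longrightarrow> moebius L u w = 0"
proof -
  interpret partial_order L by (rule L)
  let ?C = "lower_covers L w"
  have finC: "finite ?C" using L(2) unfolding lower_covers_def by simp
  define f :: "'a \<Rightarrow> int" where "f x = (\<Sum>A | A \<in> Pow ?C \<and> m A = x. (-1) ^ card A)" for x
  have "moebius L u w = f u"
  proof (rule moebius_unique[OF L w _ u])
    fix v assume v: "v \<in> carrier L" "v \<sqsubseteq>\<^bsub>L\<^esub> w"
    let ?T = "{x \<in> carrier L. v \<sqsubseteq>\<^bsub>L\<^esub> x \<and> x \<sqsubseteq>\<^bsub>L\<^esub> w}"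
    let ?S = "Pow {c \<in> ?C. v \<sqsubseteq>\<^bsub>L\<^esub> c}"
    have S: "A \<in> ?S \<longleftrightarrow> A \<in> Pow ?C \<and> v \<sqsubseteq>\<^bsub>L\<^esub> m A" for A
      using glb[of A v] v by (cases "A \<subseteq> ?C") auto
    have "(\<Sum>x\<in>?T. f x) = (\<Sum>x\<in>?T. \<Sum>A | A \<in> ?S \<and> m A = x. (-1) ^ card A)"
      unfolding f_def
    proof (rule sum.cong[OF HOL.refl])
      fix x assume "x \<in> ?T"
      then have "{A. A \<in> Pow ?C \<and> m A = x} = {A. A \<in> ?S \<and> m A = x}" using S by blast
      then show "(\<Sum>A | A \<in> Pow ?C \<and> m A = x. (-1) ^ card A :: int) =
          (\<Sum>A | A \<in> ?S \<and> m A = x. (-1) ^ card A)" by (rule sum.cong) simp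
    qed
    also have "\<dots> = (\<Sum>A\<in>?S. (-1) ^ card A)"
    proof (rule sum.group)
      show "m ` ?S \<subseteq> ?T" using m S by blast
    qed (use finC L(2) in auto)
    also have "\<dots> = (if {c \<in> ?C. v \<sqsubseteq>\<^bsub>L\<^esub> c} = {} then 1 else 0)"
      using finC by (intro sum_alternating_Pow) simp
    also have "{c \<in> ?C. v \<sqsubseteq>\<^bsub>L\<^esub> c} = {} \<longleftrightarrow> v = w"
    proof
      assume "{c \<in> ?C. v \<sqsubseteq>\<^bsub>L\<^esub> c} = {}"
      then show "v = w" using ex_lower_cover[OF L v(1) w v(2)] by blast
    next
      assume "v = w"
      then show "{c \<in> ?C. v \<sqsubseteq>\<^bsub>L\<^esub> c} = {}"
        using w by (auto simp: lower_covers_def lless_eq dest: le_antisym)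
    qed
    finally show "(\<Sum>x\<in>?T. f x) = (if v = w then 1 else 0)" .
  qed
  then show "moebius L u w = (-1) ^ card A" if "A \<subseteq> ?C" "u = m A"
  proof -
    have "{B. B \<in> Pow ?C \<and> m B = u} = {A}" using that inj by (auto dest: inj_onD)
    then show ?thesis using \<open>moebius L u w = f u\<close> by (simp add: f_def)
  qed
  show "moebius L u w = 0" if "u \<notin> m ` Pow ?C"
  proof -
    have "{B. B \<in> Pow ?C \<and> m B = u} = {}" using that by blast
    then show ?thesis using \<open>moebius L u w = f u\<close> by (simp only: f_def sum.empty)
  qed
qed

section \<open>The cutting poset\<close>

context coxeter_system
begin

abbreviation "cord \<equiv> cut_order G I s"

lemma carrier_orders [simp]:
  "carrier cord = carrier G" "carrier (left_order G I s) = carrier G"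
  "carrier (right_order G I s) = carrier G"
  by (simp_all add: cut_order_def left_order_def right_order_def)

lemma eq_cut_order [simp]: "x .=\<^bsub>cord\<^esub> y \<longleftrightarrow> x = y"
  by (simp add: cut_order_def)

lemma cut_order_iff: "w \<in> carrier G \<Longrightarrow> v \<sqsubseteq>\<^bsub>cord\<^esub> w \<longleftrightarrow> cutting_point v w"
  by (auto simp: cut_order_def right_block_iff cutting_point_def)

lemma partial_order_cut: "partial_order cord"
  by unfold_locales (auto simp: cut_order_iff fun_eq_iff intro: cut_refl cut_antisym cut_trans)

lemma least_one: "least cord \<one> (carrier cord)"
  by (simp add: least_def cut_order_iff one_cut)

lemma cut_order_le_weak:
  assumes "v \<in> carrier G" "w \<in> carrier G" "v \<sqsubseteq>\<^bsub>cord\<^esub> w"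
  shows "v \<sqsubseteq>\<^bsub>left_order G I s\<^esub> w" "v \<sqsubseteq>\<^bsub>right_order G I s\<^esub> w"
  using assms cut_left[of v w] cut_right[of v w]
  by (simp_all add: cut_order_iff left_order_iff right_order_iff)

lemma interval_carrier:
  assumes "w \<in> carrier G"
  shows "x \<in> carrier (interval_order cord u w) \<longleftrightarrow> cutting_point u x \<and> cutting_point x w"
  using assms cut_closed[of u x]
  by (auto simp: interval_order_def at_least_at_most_def cut_order_iff)

lemma interval_le:
  "x \<in> carrier (interval_order cord u w) \<Longrightarrow> y \<in> carrier (interval_order cord u w) \<Longrightarrow>
    x \<sqsubseteq>\<^bsub>interval_order cord u w\<^esub> y \<longleftrightarrow> cutting_point x y"
  by (auto simp: interval_order_def at_least_at_most_def cut_order_iff)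

text \<open>
  One element serves as the meet in left and in right order, and likewise for the join, because
  the formulas of the previous part apply to \<open>w\<close> and to its inverse with the same blocks.
\<close>

lemma interval_meet_join:
  assumes x: "cutting_point u x" "cutting_point x w" and y: "cutting_point u y" "cutting_point y w"
  obtains m j where "cutting_point u m" "cutting_point m w" "cutting_point u j" "cutting_point j w"
    "\<And>z. z \<in> carrier G \<Longrightarrow> inversions z \<subseteq> inversions m \<longleftrightarrow>
      inversions z \<subseteq> inversions x \<and> inversions z \<subseteq> inversions y"
    "\<And>z. z \<in> carrier G \<Longrightarrow> inversions (inv z) \<subseteq> inversions (inv m) \<longleftrightarrow>
      inversions (inv z) \<subseteq> inversions (inv x) \<and> inversions (inv z) \<subseteq> inversions (inv y)"
    "inversions j = inversions x \<union> inversions y"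
    "inversions (inv j) = inversions (inv x) \<union> inversions (inv y)"
proof -
  obtain J K J' K' where b: "block w J K" "x = cm w K" and b': "block w J' K'" "y = cm w K'"
    using x y unfolding cutting_point_def by blast
  note U = block_Un[OF b(1) b'(1)] and N = block_Int[OF b(1) b'(1)]
  have "cutting_point u (cm w (K \<union> K'))"
    using coset_min_Un_cut[OF b(1) b'(1)] x(1) y(1) b(2) b'(2) by simp
  moreover have "cutting_point (cm w (K \<union> K')) w" "cutting_point (cm w (K \<inter> K')) w"
    using U N unfolding cutting_point_def by blast+
  moreover have "cutting_point u (cm w (K \<inter> K'))"
    using cut_trans[OF x(1)] cut_coset_min_mono[OF N b(1)] b(2) by simp
  moreover have "inversions (inv z) \<subseteq> inversions (inv (cm w (K \<union> K'))) \<longleftrightarrow>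
      inversions (inv z) \<subseteq> inversions (inv x) \<and> inversions (inv z) \<subseteq> inversions (inv y)"
    if "z \<in> carrier G" for z
    using inversions_le_coset_min_Un[OF _ block_inv[OF b(1)] block_inv[OF b'(1)], of "inv z"] that
      coset_min_inv[OF U] coset_min_inv[OF b(1)] coset_min_inv[OF b'(1)] b(2) b'(2) by simp
  moreover have "inversions (inv (cm w (K \<inter> K'))) = inversions (inv x) \<union> inversions (inv y)"
    using inversions_coset_min_Int[OF block_inv[OF b(1)] block_inv[OF b'(1)]]
      coset_min_inv[OF N] coset_min_inv[OF b(1)] coset_min_inv[OF b'(1)] b(2) b'(2) by simp
  ultimately show ?thesis
    using that[of "cm w (K \<union> K')" "cm w (K \<inter> K')"]
      inversions_le_coset_min_Un[OF _ b(1) b'(1)] inversions_coset_min_Int[OF b(1) b'(1)] b(2) b'(2)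
    by simp
qed

lemma interval_sublattice:
  assumes w: "w \<in> carrier G"
  shows "sublattice_of (interval_order cord u w) (right_order G I s)"
    and "sublattice_of (interval_order cord u w) (left_order G I s)"
proof -
  let ?P = "interval_order cord u w"
  note P = partial_order_interval[OF partial_order_cut, of u w] and mem = interval_carrier[OF w]
  have sub: "carrier ?P \<subseteq> carrier G" by (auto simp: interval_order_def at_least_at_most_def)
  have lr: "x \<sqsubseteq>\<^bsub>?P\<^esub> y \<longleftrightarrow> x \<sqsubseteq>\<^bsub>right_order G I s\<^esub> y" "x \<sqsubseteq>\<^bsub>?P\<^esub> y \<longleftrightarrow> x \<sqsubseteq>\<^bsub>left_order G I s\<^esub> y"
    if xy: "x \<in> carrier ?P" "y \<in> carrier ?P" for x y
    using interval_le[OF xy] mem[of x] mem[of y] xy sub cut_iff_right[of x w y] cut_iff_left[of x w y]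
    by (auto simp: right_order_iff left_order_iff subset_iff[of "carrier ?P"])
  have bounds: "(\<exists>m\<in>carrier ?P. is_glb (right_order G I s) m {x, y} \<and> is_glb (left_order G I s) m {x, y}) \<and>
      (\<exists>j\<in>carrier ?P. is_lub (right_order G I s) j {x, y} \<and> is_lub (left_order G I s) j {x, y})"
    if xy: "x \<in> carrier ?P" "y \<in> carrier ?P" for x y
  proof -
    have xyc: "x \<in> carrier G" "y \<in> carrier G" using xy sub by auto
    have ux: "cutting_point u x" "cutting_point x w" "cutting_point u y" "cutting_point y w"
      using xy mem by simp_all
    obtain m j where mj: "cutting_point u m" "cutting_point m w" "cutting_point u j" "cutting_point j w"
      and m: "\<And>z. z \<in> carrier G \<Longrightarrow> inversions z \<subseteq> inversions m \<longleftrightarrow>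
        inversions z \<subseteq> inversions x \<and> inversions z \<subseteq> inversions y"
      "\<And>z. z \<in> carrier G \<Longrightarrow> inversions (inv z) \<subseteq> inversions (inv m) \<longleftrightarrow>
        inversions (inv z) \<subseteq> inversions (inv x) \<and> inversions (inv z) \<subseteq> inversions (inv y)"
      and j: "inversions j = inversions x \<union> inversions y"
      "inversions (inv j) = inversions (inv x) \<union> inversions (inv y)"
      using interval_meet_join[OF ux] by metis
    have mjP: "m \<in> carrier ?P" "j \<in> carrier ?P" using mj mem by simp_all
    then have mjc: "m \<in> carrier G" "j \<in> carrier G" using sub by auto
    have "is_glb (right_order G I s) m {x, y}" "is_glb (left_order G I s) m {x, y}"
      using m[of m] m xyc mjc by (auto intro!: is_glbI simp: right_order_iff left_order_iff)
    moreover have "is_lub (right_order G I s) j {x, y}" "is_lub (left_order G I s) j {x, y}"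
      using j xyc mjc by (auto intro!: is_lubI simp: right_order_iff left_order_iff)
    ultimately show ?thesis using mjP by blast
  qed
  show "sublattice_of ?P (right_order G I s)"
    using sub lr(1) bounds by (intro sublattice_ofI[OF P]) (simp_all, blast+)
  show "sublattice_of ?P (left_order G I s)"
    using sub lr(2) bounds by (intro sublattice_ofI[OF P]) (simp_all, blast+)
qed

section \<open>Minimal blocks and lower covers\<close>

text \<open>
  By inversion of \<open>w\<close>, the \<open>s\<^sub>d\<close> that are inversions of \<open>w\<inverse>\<close> are the right descents of \<open>w\<close>.
\<close>

lemma nontrivial_block_iff:
  assumes b: "block w J K"
  shows "cm w K \<noteq> w \<longleftrightarrow> (\<exists>d\<in>K. s d \<in> inversions (inv w))"
proof
  note w = blockD(1)[OF b] and K = blockD(3)[OF b]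
  assume ne: "cm w K \<noteq> w"
  have "inversions (inv w) \<inter> par K \<noteq> {}"
  proof
    assume "inversions (inv w) \<inter> par K = {}"
    then have "inversions (inv (cm w K)) = inversions (inv w)"
      using inversions_inv_coset_min[OF b] by blast
    then have "inv (cm w K) = inv w"
      using inversions_inject w coset_min_closed[OF w K] by simp
    then show False using ne w coset_min_closed[OF w K] inv_inv by metis
  qed
  then show "\<exists>d\<in>K. s d \<in> inversions (inv w)"
    using parabolic_inversion_descent[of "inv w" K] w K by (metis inv_closed)
next
  assume "\<exists>d\<in>K. s d \<in> inversions (inv w)"
  then obtain d where "d \<in> K" "s d \<in> inversions (inv w)" by blast
  then have "inversions (inv (cm w K)) \<noteq> inversions (inv w)"
    using inversions_inv_coset_min[OF b] parabolic_simple[of d K] by blast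
  then show "cm w K \<noteq> w" by metis
qed

lemma min_blocks_iff:
  assumes w: "w \<in> carrier G"
  shows "K \<in> min_blocks G I s w \<longleftrightarrow> (\<exists>J. block w J K) \<and> cm w K \<noteq> w \<and>
    (\<forall>J' K'. block w J' K' \<longrightarrow> K' \<subset> K \<longrightarrow> cm w K' = w)"
  by (auto simp: min_blocks_def nontrivial_right_block_def right_block_iff[OF w])

lemma min_blockE:
  assumes "w \<in> carrier G" "K \<in> min_blocks G I s w" obtains J where "block w J K"
  using assms min_blocks_iff by blast

text \<open>
  Blocks are closed under intersection, so a minimal nontrivial block meets any other block
  either in a trivial block or in itself.
\<close>

lemma min_block_subset:
  assumes w: "w \<in> carrier G" and K: "K \<in> min_blocks G I s w" and b: "block w J' M"
    and ne: "cm w (M \<inter> K) \<noteq> w"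
  shows "K \<subseteq> M"
proof -
  obtain J where "block w J K" using min_blockE[OF w K] .
  then have "block w (J' \<inter> J) (M \<inter> K)" using block_Int b by simp
  then have "\<not> M \<inter> K \<subset> K" using K ne min_blocks_iff[OF w] by blast
  then show ?thesis by blast
qed

lemma block_Union_min_blocks:
  assumes w: "w \<in> carrier G" and \<K>: "\<K> \<subseteq> min_blocks G I s w"
  obtains f where "\<And>K. K \<in> \<K> \<Longrightarrow> block w (f K) K" "block w (\<Union>K\<in>\<K>. f K) (\<Union>\<K>)"
proof -
  have "\<forall>K\<in>\<K>. \<exists>J. block w J K" using \<K> min_blocks_iff[OF w] by blast
  then obtain f where f: "\<And>K. K \<in> \<K> \<Longrightarrow> block w (f K) K" by metis
  from block_UN[OF w, of \<K> f "\<lambda>K. K", OF f] show ?thesis using that[OF f] by simp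
qed

text \<open>
  A descent of \<open>w\<close> in \<open>L\<close> that was also in \<open>K\<close> would make the block \<open>K \<inter> L\<close> nontrivial, and
  minimality would force \<open>K = L\<close>.
\<close>

lemma min_block_own_descent:
  assumes w: "w \<in> carrier G" and \<K>: "\<K> \<subseteq> min_blocks G I s w"
    and L: "L \<in> min_blocks G I s w" "L \<notin> \<K>"
  obtains d where "d \<in> L" "d \<notin> \<Union>\<K>" "s d \<in> inversions (inv w)"
proof -
  obtain J where J: "block w J L" using min_blockE[OF w L(1)] .
  obtain d where d: "d \<in> L" "s d \<in> inversions (inv w)"
    using nontrivial_block_iff[OF J] L(1) min_blocks_iff[OF w] by blast
  have "d \<notin> K" if K: "K \<in> \<K>" for K
  proof
    assume dK: "d \<in> K"
    have KM: "K \<in> min_blocks G I s w" using K \<K> by blast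
    obtain J' where J': "block w J' K" using min_blockE[OF w KM] .
    have "cm w (K \<inter> L) \<noteq> w"
      using nontrivial_block_iff[OF block_Int[OF J' J]] d dK by blast
    then have "L \<subseteq> K" "K \<subseteq> L"
      using min_block_subset[OF w L(1) J'] min_block_subset[OF w KM J] by (simp_all add: Int_commute)
    then have "K = L" by (intro equalityI)
    then show False using K L(2) by simp
  qed
  then show ?thesis using that d by blast
qed

text \<open>
  If \<open>K\<close> is not in \<open>\<L>\<close>, its own descent survives in the cutting point of \<open>\<Union>\<L>\<close> and is removed in that
  of \<open>\<Union>\<K>\<close>, so the former is not below the latter.
\<close>

lemma cut_Union_min_blocks:
  assumes w: "w \<in> carrier G" and \<K>: "\<K> \<subseteq> min_blocks G I s w" and \<L>: "\<L> \<subseteq> min_blocks G I s w"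
  shows "cutting_point (cm w (\<Union>\<L>)) (cm w (\<Union>\<K>)) \<longleftrightarrow> \<K> \<subseteq> \<L>"
    and "cutting_point (cm w (\<Union>\<L>)) (cm w (\<Union>\<K>)) \<longleftrightarrow> \<Union>\<K> \<subseteq> \<Union>\<L>"
proof -
  obtain J where J: "block w J (\<Union>\<K>)" using block_Union_min_blocks[OF w \<K>] by metis
  obtain J' where J': "block w J' (\<Union>\<L>)" using block_Union_min_blocks[OF w \<L>] by metis
  have mono: "cutting_point (cm w (\<Union>\<L>)) (cm w (\<Union>\<K>))" if "\<Union>\<K> \<subseteq> \<Union>\<L>"
    using cut_coset_min_mono[OF J J' that] .
  have "\<K> \<subseteq> \<L>" if c: "cutting_point (cm w (\<Union>\<L>)) (cm w (\<Union>\<K>))"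
  proof
    fix K assume K: "K \<in> \<K>"
    show "K \<in> \<L>"
    proof (rule ccontr)
      assume "K \<notin> \<L>"
      then obtain d where d: "d \<in> K" "d \<notin> \<Union>\<L>" "s d \<in> inversions (inv w)"
        using min_block_own_descent[OF w \<L>] K \<K> by blast
      have "d \<in> I" using blockD(3)[OF J] K d(1) by blast
      then have "s d \<notin> par (\<Union>\<L>)" using simple_in_parabolic[OF blockD(3)[OF J']] d(2) by blast
      then have "s d \<in> inversions (inv (cm w (\<Union>\<L>)))"
        using d(3) inversions_inv_coset_min[OF J'] by blast
      then have "s d \<in> inversions (inv (cm w (\<Union>\<K>)))" using cut_left[OF c] by blast
      moreover have "s d \<in> par (\<Union>\<K>)" using parabolic_simple[of d "\<Union>\<K>"] d(1) K by blast
      ultimately show False using inversions_inv_coset_min[OF J] by blast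
    qed
  qed
  then show "cutting_point (cm w (\<Union>\<L>)) (cm w (\<Union>\<K>)) \<longleftrightarrow> \<K> \<subseteq> \<L>"
    "cutting_point (cm w (\<Union>\<L>)) (cm w (\<Union>\<K>)) \<longleftrightarrow> \<Union>\<K> \<subseteq> \<Union>\<L>"
    using mono Union_mono[of \<K> \<L>] by blast+
qed

lemma coset_min_Union_inject:
  assumes "w \<in> carrier G" "\<K> \<subseteq> min_blocks G I s w" "\<L> \<subseteq> min_blocks G I s w"
    and "cm w (\<Union>\<K>) = cm w (\<Union>\<L>)"
  shows "\<K> = \<L>"
proof -
  obtain J where J: "block w J (\<Union>\<K>)" using block_Union_min_blocks[OF assms(1,2)] by metis
  have "cutting_point (cm w (\<Union>\<K>)) (cm w (\<Union>\<K>))"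
    using cut_refl coset_min_closed[OF assms(1) blockD(3)[OF J]] by simp
  then show ?thesis
    using cut_Union_min_blocks(1)[OF assms(1-3)] cut_Union_min_blocks(1)[OF assms(1,3,2)] assms(4)
    by simp
qed

lemma cut_covers_iff:
  assumes w: "w \<in> carrier G"
  shows "v \<in> cut_covers G I s w \<longleftrightarrow> cutting_point v w \<and> v \<noteq> w \<and>
    (\<forall>x. cutting_point v x \<longrightarrow> cutting_point x w \<longrightarrow> x = v \<or> x = w)"
proof -
  have "cutting_point x y \<Longrightarrow> x \<in> carrier G" "cutting_point x y \<Longrightarrow> y \<in> carrier G" for x y
    using cut_closed by blast+
  then show ?thesis using w
    unfolding cut_covers_def lower_covers_def lless_def by (auto simp: cut_order_iff)
qed

text \<open>
  If \<open>x\<close> is between \<open>w\<^sup>K\<close> and \<open>w\<close> with \<open>x = w\<^sup>M\<close>, then \<open>x\<close> is the join of the two, cut off by \<open>M \<inter> K\<close>;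
  for minimal \<open>K\<close> either this block is trivial and \<open>x = w\<close>, or \<open>K \<subseteq> M\<close> and \<open>x = w\<^sup>K\<close>. Conversely every cutting
  point other than \<open>w\<close> lies below the one of a minimal block contained in its own.
\<close>

lemma bij_min_blocks_cut_covers:
  assumes fin: "finite I" and w: "w \<in> carrier G"
  shows "bij_betw (cm w) (min_blocks G I s w) (cut_covers G I s w)"
  unfolding bij_betw_def
proof (intro conjI equalityI subsetI)
  show "inj_on (cm w) (min_blocks G I s w)"
    using coset_min_Union_inject[OF w, of "{_}" "{_}"] by (intro inj_onI) simp
next
  fix v assume "v \<in> cm w ` min_blocks G I s w"
  then obtain K where K: "K \<in> min_blocks G I s w" "v = cm w K" by blast
  obtain J where J: "block w J K" using min_blockE[OF w K(1)] .
  have "x = v \<or> x = w" if vx: "cutting_point v x" and xw: "cutting_point x w" for x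
  proof (cases "x = w")
    case False
    obtain J' M where M: "block w J' M" "x = cm w M" using xw unfolding cutting_point_def by blast
    have "inversions (cm w (M \<inter> K)) = inversions x"
      using inversions_coset_min_Int[OF M(1) J] M(2) K(2) cut_right[OF vx] by blast
    then have "cm w (M \<inter> K) \<noteq> w"
      using False inversions_inject[of x w] w cut_closed[OF xw] by metis
    then have "K \<subseteq> M" using min_block_subset[OF w K(1) M(1)] by simp
    then have "cutting_point x v" using cut_coset_min_mono[OF J M(1)] K(2) M(2) by simp
    then show ?thesis using cut_antisym vx by simp
  qed simp
  moreover have "v \<noteq> w" using K min_blocks_iff[OF w, of K] by simp
  moreover have "cutting_point v w" using J K(2) unfolding cutting_point_def by blast
  ultimately show "v \<in> cut_covers G I s w" by (simp add: cut_covers_iff[OF w])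
next
  fix v assume v: "v \<in> cut_covers G I s w"
  then have vw: "cutting_point v w" and ne: "v \<noteq> w"
    and max: "\<And>x. cutting_point v x \<Longrightarrow> cutting_point x w \<Longrightarrow> x = v \<or> x = w"
    using cut_covers_iff[OF w, of v] by simp_all
  obtain J K where K: "block w J K" "v = cm w K" using vw unfolding cutting_point_def by blast
  let ?N = "{M. (\<exists>J. block w J M) \<and> cm w M \<noteq> w \<and> M \<subseteq> K}"
  have "finite K" using finite_subset[OF blockD(3)[OF K(1)] fin] .
  then have "finite ?N" by (intro finite_subset[of ?N "Pow K"]) auto
  moreover have "K \<in> ?N" using K ne by blast
  ultimately have "\<exists>M\<in>?N. \<forall>M'\<in>?N. M' \<subseteq> M \<longrightarrow> M = M'"
    by (intro finite_has_minimal) auto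
  then obtain M where M: "M \<in> ?N" and min: "\<forall>M'\<in>?N. M' \<subseteq> M \<longrightarrow> M = M'" by (elim bexE)
  from M obtain J' where J': "block w J' M" by blast
  have "M \<in> min_blocks G I s w"
    unfolding min_blocks_iff[OF w]
  proof (intro conjI allI impI)
    fix J1 M' assume M': "block w J1 M'" "M' \<subset> M"
    show "cm w M' = w"
    proof (rule ccontr)
      assume "cm w M' \<noteq> w"
      then have "M' \<in> ?N" using M' M by blast
      then show False using min M'(2) by blast
    qed
  qed (use M in auto)
  moreover have "cutting_point v (cm w M)" using cut_coset_min_mono[OF J' K(1)] M K(2) by simp
  moreover have "cutting_point (cm w M) w" using J' unfolding cutting_point_def by blast
  ultimately have "cm w M = v" using max[of "cm w M"] M by simp
  then show "v \<in> cm w ` min_blocks G I s w" using \<open>M \<in> min_blocks G I s w\<close> by blast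
qed

lemma cut_le_Union_iff:
  assumes w: "w \<in> carrier G" and \<K>: "\<K> \<subseteq> min_blocks G I s w" and x: "cutting_point x w"
  shows "cutting_point x (cm w (\<Union>\<K>)) \<longleftrightarrow> (\<forall>K\<in>\<K>. cutting_point x (cm w K))"
proof -
  obtain f where f: "\<And>K. K \<in> \<K> \<Longrightarrow> block w (f K) K" and U: "block w (\<Union>K\<in>\<K>. f K) (\<Union>\<K>)"
    using block_Union_min_blocks[OF w \<K>] by metis
  have xc: "x \<in> carrier G" using cut_closed x by blast
  have cK: "cutting_point (cm w K) w" if "K \<in> \<K>" for K
    using f[OF that] unfolding cutting_point_def by blast
  have cU: "cutting_point (cm w (\<Union>\<K>)) w" using U unfolding cutting_point_def by blast
  have "cutting_point x (cm w (\<Union>\<K>)) \<longleftrightarrow> inversions x \<subseteq> inversions (cm w (\<Union>\<K>))"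
    using cut_iff_right[OF x cU] .
  also have "\<dots> \<longleftrightarrow> (\<forall>K\<in>\<K>. inversions x \<subseteq> inversions (cm w K))"
    using inversions_le_coset_min_UN[OF w xc, of \<K> f "\<lambda>K. K", OF f] cut_right[OF x] by simp
  also have "\<dots> \<longleftrightarrow> (\<forall>K\<in>\<K>. cutting_point x (cm w K))"
    using cut_iff_right[OF x cK] by blast
  finally show ?thesis .
qed

lemma cutting_point_Union:
  assumes "w \<in> carrier G" "\<K> \<subseteq> min_blocks G I s w"
  shows "cutting_point (cm w (\<Union>\<K>)) w"
  using block_Union_min_blocks[OF assms] unfolding cutting_point_def by (metis (no_types))

section \<open>Meets of lower covers\<close>

lemma cut_meet_eq:
  assumes w: "w \<in> carrier G" and \<K>: "\<K> \<subseteq> min_blocks G I s w"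
  shows "cut_meet G I s w (cm w ` \<K>) = cm w (\<Union>\<K>)"
proof -
  let ?P = "interval_order cord \<one> w"
  interpret P: partial_order ?P by (rule partial_order_interval[OF partial_order_cut])
  have mem: "x \<in> carrier ?P \<longleftrightarrow> cutting_point x w" for x
    using interval_carrier[OF w] one_cut cut_closed by blast
  have le: "x \<sqsubseteq>\<^bsub>?P\<^esub> y \<longleftrightarrow> cutting_point x y" if "cutting_point x w" "cutting_point y w" for x y
    using interval_le[of x \<one> w y] mem that by simp
  note U = cutting_point_Union[OF w \<K>]
  have "is_glb ?P (cm w (\<Union>\<K>)) (cm w ` \<K>)"
  proof (rule is_glbI)
    show "cm w (\<Union>\<K>) \<in> carrier ?P" using U mem by simp
    have "cutting_point (cm w (\<Union>\<K>)) (cm w (\<Union>\<K>))" using cut_refl cut_closed[OF U] by simp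
    then have "\<forall>K\<in>\<K>. cutting_point (cm w (\<Union>\<K>)) (cm w K)"
      using cut_le_Union_iff[OF w \<K> U] by simp
    then show "cm w (\<Union>\<K>) \<sqsubseteq>\<^bsub>?P\<^esub> x" if "x \<in> cm w ` \<K>" "x \<in> carrier ?P" for x
      using that le[OF U, of x] mem by auto
    show "z \<sqsubseteq>\<^bsub>?P\<^esub> cm w (\<Union>\<K>)" if z: "z \<in> carrier ?P"
      and below: "\<And>x. x \<in> cm w ` \<K> \<Longrightarrow> x \<in> carrier ?P \<Longrightarrow> z \<sqsubseteq>\<^bsub>?P\<^esub> x" for z
    proof -
      have zw: "cutting_point z w" using z mem by simp
      have "cutting_point z (cm w K)" if K: "K \<in> \<K>" for K
      proof -
        have "cutting_point (cm w K) w"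
          using cutting_point_Union[OF w, of "{K}"] K \<K> by auto
        then show ?thesis using le[OF zw, of "cm w K"] mem below[of "cm w K"] K by simp
      qed
      then show ?thesis using le[OF zw U] cut_le_Union_iff[OF w \<K> zw] by simp
    qed
  qed
  then show ?thesis using P.inf_eqI by (simp add: cut_meet_def)
qed

lemma right_ideal_eq:
  assumes "x \<in> carrier G"
  shows "right_ideal G I s x = {y \<in> carrier G. inversions y \<subseteq> inversions x}"
  using assms by (auto simp: right_ideal_def at_least_at_most_def right_order_iff)

lemma right_ideal_Union:
  assumes w: "w \<in> carrier G" and \<K>: "\<K> \<subseteq> min_blocks G I s w"
  shows "right_ideal G I s (cm w (\<Union>\<K>)) = ideal_Inter G I s w (cm w ` \<K>)"
proof -
  obtain f where f: "\<And>K. K \<in> \<K> \<Longrightarrow> block w (f K) K"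
    using block_Union_min_blocks[OF w \<K>] by metis
  have cK: "cm w K \<in> carrier G" if "K \<in> \<K>" for K
    using coset_min_closed[OF w blockD(3)[OF f[OF that]]] .
  have cU: "cm w (\<Union>\<K>) \<in> carrier G"
    using cutting_point_Union[OF w \<K>] cut_closed by blast
  have "x \<in> right_ideal G I s (cm w (\<Union>\<K>)) \<longleftrightarrow> x \<in> ideal_Inter G I s w (cm w ` \<K>)" for x
  proof (cases "x \<in> carrier G")
    case True
    then show ?thesis
      using inversions_le_coset_min_UN[OF w True, of \<K> f "\<lambda>K. K", OF f] cK cU w
      by (simp add: ideal_Inter_def right_ideal_eq)
  qed (use cU w in \<open>simp add: ideal_Inter_def right_ideal_eq\<close>)
  then show ?thesis by blast
qed

lemma right_ideal_subset_iff:
  assumes "cutting_point u w" "cutting_point v w"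
  shows "cutting_point u v \<longleftrightarrow> right_ideal G I s u \<subseteq> right_ideal G I s v"
proof -
  have c: "u \<in> carrier G" "v \<in> carrier G" using assms cut_closed by blast+
  then have "right_ideal G I s u \<subseteq> right_ideal G I s v \<longleftrightarrow> inversions u \<subseteq> inversions v"
    by (auto simp: right_ideal_eq)
  then show ?thesis using cut_iff_right[OF assms] by simp
qed

lemma finite_simple_index:
  assumes "finite (carrier G)" shows "finite I"
proof -
  have "s ` I \<subseteq> carrier G" by auto
  then have "finite (s ` I)" using assms finite_subset by blast
  then show ?thesis using finite_imageD simple_inj by blast
qed

lemma subset_cut_coversE:
  assumes "finite I" "w \<in> carrier G" "A \<subseteq> cut_covers G I s w"
  obtains \<K> where "\<K> \<subseteq> min_blocks G I s w" "A = cm w ` \<K>"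
proof -
  have "A \<subseteq> cm w ` min_blocks G I s w"
    using bij_min_blocks_cut_covers[OF assms(1,2)] assms(3) by (simp add: bij_betw_def)
  then show ?thesis using that by (meson subset_imageE)
qed

lemma inj_cut_meet:
  assumes I: "finite I" and w: "w \<in> carrier G"
  shows "inj_on (cut_meet G I s w) (Pow (cut_covers G I s w))"
proof (rule inj_onI)
  fix A B assume "A \<in> Pow (cut_covers G I s w)" "B \<in> Pow (cut_covers G I s w)"
    and eq: "cut_meet G I s w A = cut_meet G I s w B"
  then have sub: "A \<subseteq> cut_covers G I s w" "B \<subseteq> cut_covers G I s w" by simp_all
  obtain \<K> where \<K>: "\<K> \<subseteq> min_blocks G I s w" "A = cm w ` \<K>"
    using subset_cut_coversE[OF I w sub(1)] .
  obtain \<L> where \<L>: "\<L> \<subseteq> min_blocks G I s w" "B = cm w ` \<L>"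
    using subset_cut_coversE[OF I w sub(2)] .
  have "cm w (\<Union>\<K>) = cm w (\<Union>\<L>)"
    using eq cut_meet_eq[OF w \<K>(1)] cut_meet_eq[OF w \<L>(1)] \<K>(2) \<L>(2) by simp
  then show "A = B" using coset_min_Union_inject[OF w \<K>(1) \<L>(1)] \<K>(2) \<L>(2) by simp
qed

lemma cover_meets_eq:
  assumes I: "finite I" and w: "w \<in> carrier G"
  shows "cover_meets G I s w = (\<lambda>\<K>. cm w (\<Union>\<K>)) ` Pow (min_blocks G I s w)"
proof -
  have "Pow (cut_covers G I s w) = (\<lambda>\<K>. cm w ` \<K>) ` Pow (min_blocks G I s w)"
    using bij_min_blocks_cut_covers[OF I w] by (simp add: bij_betw_def image_Pow_surj)
  then have "cover_meets G I s w = (\<lambda>\<K>. cut_meet G I s w (cm w ` \<K>)) ` Pow (min_blocks G I s w)"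
    by (simp add: cover_meets_def image_image)
  also have "\<dots> = (\<lambda>\<K>. cm w (\<Union>\<K>)) ` Pow (min_blocks G I s w)"
    by (rule image_cong) (simp_all add: cut_meet_eq[OF w])
  finally show ?thesis .
qed

lemma bij_Union_cover_meets:
  assumes I: "finite I" and w: "w \<in> carrier G"
  shows "bij_betw (cm w) (Union ` Pow (min_blocks G I s w)) (cover_meets G I s w)"
  unfolding bij_betw_def
proof
  show "inj_on (cm w) (Union ` Pow (min_blocks G I s w))"
  proof (rule inj_onI)
    fix U V assume "U \<in> Union ` Pow (min_blocks G I s w)" "V \<in> Union ` Pow (min_blocks G I s w)"
      and eq: "cm w U = cm w V"
    then obtain \<K> \<L> where "\<K> \<subseteq> min_blocks G I s w" "U = \<Union>\<K>" "\<L> \<subseteq> min_blocks G I s w" "V = \<Union>\<L>"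
      by auto
    then show "U = V" using coset_min_Union_inject[OF w, of \<K> \<L>] eq by simp
  qed
  show "cm w ` Union ` Pow (min_blocks G I s w) = cover_meets G I s w"
    by (simp add: cover_meets_eq[OF I w] image_image)
qed

lemma cover_meets_cutting_point:
  assumes "finite I" "w \<in> carrier G" "u \<in> cover_meets G I s w"
  shows "cutting_point u w"
  using assms cutting_point_Union[OF assms(2)] by (auto simp: cover_meets_eq)

lemma right_ideal_cut_meet:
  assumes I: "finite I" and w: "w \<in> carrier G" and A: "A \<subseteq> cut_covers G I s w"
  shows "right_ideal G I s (cut_meet G I s w A) = ideal_Inter G I s w A"
proof -
  obtain \<K> where \<K>: "\<K> \<subseteq> min_blocks G I s w" "A = cm w ` \<K>"
    using subset_cut_coversE[OF I w A] .
  then show ?thesis using right_ideal_Union[OF w \<K>(1)] cut_meet_eq[OF w \<K>(1)] by simp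
qed

lemma bij_right_ideal:
  assumes I: "finite I" and w: "w \<in> carrier G"
  shows "bij_betw (right_ideal G I s) (cover_meets G I s w)
    (ideal_Inter G I s w ` Pow (cut_covers G I s w))"
  unfolding bij_betw_def
proof
  show "inj_on (right_ideal G I s) (cover_meets G I s w)"
  proof (rule inj_onI)
    fix u v assume "u \<in> cover_meets G I s w" "v \<in> cover_meets G I s w"
      and eq: "right_ideal G I s u = right_ideal G I s v"
    then have uv: "cutting_point u w" "cutting_point v w"
      using cover_meets_cutting_point[OF I w] by simp_all
    then have "cutting_point u v" "cutting_point v u"
      using right_ideal_subset_iff[OF uv] right_ideal_subset_iff[OF uv(2,1)] eq by simp_all
    then show "u = v" using cut_antisym by simp
  qed
  show "right_ideal G I s ` cover_meets G I s w = ideal_Inter G I s w ` Pow (cut_covers G I s w)"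
    unfolding cover_meets_def image_image
    by (rule image_cong) (simp_all add: right_ideal_cut_meet[OF I w])
qed

lemma cut_meet_below:
  assumes I: "finite I" and w: "w \<in> carrier G" and A: "A \<subseteq> cut_covers G I s w"
  shows "cutting_point (cut_meet G I s w A) w"
    and "cutting_point v w \<Longrightarrow> cutting_point v (cut_meet G I s w A) \<longleftrightarrow> (\<forall>c\<in>A. cutting_point v c)"
proof -
  obtain \<K> where \<K>: "\<K> \<subseteq> min_blocks G I s w" "A = cm w ` \<K>"
    using subset_cut_coversE[OF I w A] .
  show "cutting_point (cut_meet G I s w A) w"
    using cutting_point_Union[OF w \<K>(1)] cut_meet_eq[OF w \<K>(1)] \<K>(2) by simp
  show "cutting_point v (cut_meet G I s w A) \<longleftrightarrow> (\<forall>c\<in>A. cutting_point v c)" if "cutting_point v w"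
    using cut_le_Union_iff[OF w \<K>(1) that] cut_meet_eq[OF w \<K>(1)] \<K>(2) by simp
qed

lemma moebius_cut_order:
  assumes fin: "finite (carrier G)" and w: "w \<in> carrier G" and u: "u \<in> carrier G" "u \<sqsubseteq>\<^bsub>cord\<^esub> w"
  shows "A \<subseteq> cut_covers G I s w \<Longrightarrow> u = cut_meet G I s w A \<Longrightarrow> moebius cord u w = (-1) ^ card A"
    and "u \<notin> cover_meets G I s w \<Longrightarrow> moebius cord u w = 0"
proof -
  note I = finite_simple_index[OF fin]
  have f: "finite (carrier cord)" and wc: "w \<in> carrier cord" and uc: "u \<in> carrier cord"
    using fin w u by simp_all
  have m: "cut_meet G I s w A \<in> carrier cord \<and> cut_meet G I s w A \<sqsubseteq>\<^bsub>cord\<^esub> w"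
    if "A \<subseteq> lower_covers cord w" for A
    using cut_meet_below(1)[OF I w, of A] that cut_closed[of "cut_meet G I s w A" w]
    by (simp add: cut_covers_def cut_order_iff w)
  have glb: "v \<sqsubseteq>\<^bsub>cord\<^esub> cut_meet G I s w A \<longleftrightarrow> (\<forall>c\<in>A. v \<sqsubseteq>\<^bsub>cord\<^esub> c)"
    if A: "A \<subseteq> lower_covers cord w" and v: "v \<in> carrier cord" "v \<sqsubseteq>\<^bsub>cord\<^esub> w" for A v
  proof -
    have "\<forall>c\<in>A. c \<in> carrier G" using A by (auto simp: lower_covers_def)
    then show ?thesis
      using cut_meet_below(2)[OF I w, of A v] A v m[OF A]
      by (simp add: cut_covers_def cut_order_iff w)
  qed
  note M = moebius_cover_meets[OF partial_order_cut f wc m glb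
      inj_cut_meet[OF I w, unfolded cut_covers_def] uc u(2)]
  show "A \<subseteq> cut_covers G I s w \<Longrightarrow> u = cut_meet G I s w A \<Longrightarrow> moebius cord u w = (-1) ^ card A"
    using M(1)[of A] by (simp add: cut_covers_def)
  show "u \<notin> cover_meets G I s w \<Longrightarrow> moebius cord u w = 0"
    using M(2) by (simp add: cut_covers_def cover_meets_def)
qed

lemma Union_min_blocks_subset_iff:
  assumes w: "w \<in> carrier G"
    and U: "U \<in> Union ` Pow (min_blocks G I s w)" and V: "V \<in> Union ` Pow (min_blocks G I s w)"
  shows "U \<subseteq> V \<longleftrightarrow> cm w V \<sqsubseteq>\<^bsub>cord\<^esub> cm w U"
proof -
  obtain \<K> \<L> where \<K>: "\<K> \<subseteq> min_blocks G I s w" "U = \<Union>\<K>" and \<L>: "\<L> \<subseteq> min_blocks G I s w" "V = \<Union>\<L>"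
    using U V by auto
  have "cm w U \<in> carrier G" using cutting_point_Union[OF w \<K>(1)] cut_closed \<K>(2) by simp
  then show ?thesis
    using cut_Union_min_blocks(2)[OF w \<K>(1) \<L>(1)] \<K>(2) \<L>(2) by (simp add: cut_order_iff)
qed

lemma cover_meets_le_iff:
  assumes I: "finite I" and w: "w \<in> carrier G"
    and u: "u \<in> cover_meets G I s w" and v: "v \<in> cover_meets G I s w"
  shows "u \<sqsubseteq>\<^bsub>cord\<^esub> v \<longleftrightarrow> right_ideal G I s u \<subseteq> right_ideal G I s v"
proof -
  note c = cover_meets_cutting_point[OF I w u] cover_meets_cutting_point[OF I w v]
  have "v \<in> carrier G" using cut_closed[OF c(2)] by simp
  then show ?thesis using right_ideal_subset_iff[OF c] by (simp add: cut_order_iff)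
qed

end

theorem theorem2p9:
  fixes G :: "('a, 'b) monoid_scheme" and I :: "'i set" and s :: "'i \<Rightarrow> 'a"
  assumes "coxeter_system G I s" and "finite (carrier G)"
  shows
    "(partial_order (cut_order G I s)
     \<and> least (cut_order G I s) \<one>\<^bsub>G\<^esub> (carrier (cut_order G I s))
     \<and> (\<forall>v \<in> carrier G. \<forall>w \<in> carrier G. v \<sqsubseteq>\<^bsub>cut_order G I s\<^esub> w \<longrightarrow>
          v \<sqsubseteq>\<^bsub>left_order G I s\<^esub> w \<and> v \<sqsubseteq>\<^bsub>right_order G I s\<^esub> w)
     \<and> (\<forall>u \<in> carrier G. \<forall>w \<in> carrier G. u \<sqsubseteq>\<^bsub>cut_order G I s\<^esub> w \<longrightarrow>
          sublattice_of (interval_order (cut_order G I s) u w) (left_order G I s) \<and>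
          sublattice_of (interval_order (cut_order G I s) u w) (right_order G I s)))
     \<and>
     (\<forall>w \<in> carrier G.
       bij_betw (coset_min G I s w) (min_blocks G I s w) (cut_covers G I s w)
       \<and> inj_on (cut_meet G I s w) (Pow (cut_covers G I s w))
       \<and> bij_betw (coset_min G I s w) (Union ` Pow (min_blocks G I s w)) (cover_meets G I s w)
       \<and> (\<forall>\<K> \<subseteq> min_blocks G I s w.
            coset_min G I s w (\<Union>\<K>) = cut_meet G I s w (coset_min G I s w ` \<K>))
       \<and> (\<forall>U \<in> Union ` Pow (min_blocks G I s w). \<forall>V \<in> Union ` Pow (min_blocks G I s w).
            U \<subseteq> V \<longleftrightarrow> coset_min G I s w V \<sqsubseteq>\<^bsub>cut_order G I s\<^esub> coset_min G I s w U)
       \<and> bij_betw (right_ideal G I s) (cover_meets G I s w)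
            (ideal_Inter G I s w ` Pow (cut_covers G I s w))
       \<and> (\<forall>A \<subseteq> cut_covers G I s w.
            right_ideal G I s (cut_meet G I s w A) = ideal_Inter G I s w A)
       \<and> (\<forall>u \<in> cover_meets G I s w. \<forall>v \<in> cover_meets G I s w.
            u \<sqsubseteq>\<^bsub>cut_order G I s\<^esub> v \<longleftrightarrow> right_ideal G I s u \<subseteq> right_ideal G I s v))
     \<and>
     (\<forall>u \<in> carrier G. \<forall>w \<in> carrier G. u \<sqsubseteq>\<^bsub>cut_order G I s\<^esub> w \<longrightarrow>
       (\<forall>A \<subseteq> cut_covers G I s w. u = cut_meet G I s w A \<longrightarrow>
          moebius (cut_order G I s) u w = (-1) ^ card A)
       \<and> (u \<notin> cover_meets G I s w \<longrightarrow> moebius (cut_order G I s) u w = 0))"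
proof -
  interpret coxeter_system G I s by (rule assms(1))
  note I = finite_simple_index[OF assms(2)]
  show ?thesis
  proof (intro conjI ballI allI impI)
    show "partial_order cord" by (rule partial_order_cut)
    show "least cord \<one>\<^bsub>G\<^esub> (carrier cord)" by (rule least_one)
  next
    fix v w assume "v \<in> carrier G" "w \<in> carrier G" "v \<sqsubseteq>\<^bsub>cord\<^esub> w"
    then show "v \<sqsubseteq>\<^bsub>left_order G I s\<^esub> w" "v \<sqsubseteq>\<^bsub>right_order G I s\<^esub> w"
      by (rule cut_order_le_weak)+
  next
    fix u w assume w: "w \<in> carrier G"
    show "sublattice_of (interval_order cord u w) (left_order G I s)"
      "sublattice_of (interval_order cord u w) (right_order G I s)"
      by (rule interval_sublattice[OF w])+
  next
    fix w assume w: "w \<in> carrier G"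
    show "bij_betw (cm w) (min_blocks G I s w) (cut_covers G I s w)"
      by (rule bij_min_blocks_cut_covers[OF I w])
    show "inj_on (cut_meet G I s w) (Pow (cut_covers G I s w))"
      by (rule inj_cut_meet[OF I w])
    show "bij_betw (cm w) (Union ` Pow (min_blocks G I s w)) (cover_meets G I s w)"
      by (rule bij_Union_cover_meets[OF I w])
    show "cm w (\<Union>\<K>) = cut_meet G I s w (cm w ` \<K>)" if "\<K> \<subseteq> min_blocks G I s w" for \<K>
      using cut_meet_eq[OF w that] by simp
    show "U \<subseteq> V \<longleftrightarrow> cm w V \<sqsubseteq>\<^bsub>cord\<^esub> cm w U"
      if "U \<in> Union ` Pow (min_blocks G I s w)" "V \<in> Union ` Pow (min_blocks G I s w)" for U V
      using that by (rule Union_min_blocks_subset_iff[OF w])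
    show "bij_betw (right_ideal G I s) (cover_meets G I s w)
        (ideal_Inter G I s w ` Pow (cut_covers G I s w))"
      by (rule bij_right_ideal[OF I w])
    show "right_ideal G I s (cut_meet G I s w A) = ideal_Inter G I s w A"
      if "A \<subseteq> cut_covers G I s w" for A
      using that by (rule right_ideal_cut_meet[OF I w])
    show "u \<sqsubseteq>\<^bsub>cord\<^esub> v \<longleftrightarrow> right_ideal G I s u \<subseteq> right_ideal G I s v"
      if "u \<in> cover_meets G I s w" "v \<in> cover_meets G I s w" for u v
      using that by (rule cover_meets_le_iff[OF I w])
  next
    fix u w assume u: "u \<in> carrier G" and w: "w \<in> carrier G" and le: "u \<sqsubseteq>\<^bsub>cord\<^esub> w"
    show "moebius cord u w = (-1) ^ card A"
      if "A \<subseteq> cut_covers G I s w" "u = cut_meet G I s w A" for A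
      using that by (rule moebius_cut_order(1)[OF assms(2) w u le])
    show "moebius cord u w = 0" if "u \<notin> cover_meets G I s w"
      using that by (rule moebius_cut_order(2)[OF assms(2) w u le])
  qed
qed

end
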